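(* Let $T$ be an ergodic endomorphism of a probability space $(X,\mathcal{B},m)$. Let $Y\subset X$ be a set with positive measure, and let $f:X\to\mathbb{R}$ be an integrable function. Let $B:(0,\infty)\to(0,\infty)$ be a renormalization function. Assume that $S_n^Yf_Y/B(n/m(Y))$ converges with tight maxima to a random variable $\mathcal{W}$, for the measure $m_Y$. Then $S_nf/B(n)$ converges in law to $\mathcal{W}$, for the measure $m$.
   Context: An ergodic endomorphism is an ergodic measure-preserving map. $S_nf=\sum_{k=0}^{n-1}f\circ T^k$. For $y\in Y$, $\phi(y)=\inf\{n>0: T^ny\in Y\}$ is the first return time; $f_Y(y)=\sum_{k=0}^{\phi(y)-1}f(T^ky)$ if $y\in Y$ and $f_Y(y)=0$ if $y\notin Y$. $T_Y:Y\to Y$, $T_Yy=T^{\phi(y)}y$, is the induced map (defined almost everywhere), $m_Y=m(Y)^{-1}m_{|Y}$ is its invariant probability measure, and $S_k^Y$ denotes Birkhoff sums for $T_Y$: $S_k^Yg=\sum_{j=0}^{k-1}g\circ T_Y^j$. A continuous $L:(0,\infty)\to(0,\infty)$ is slowly varying if $L(\lambda x)/L(x)\to1$ as $x\to\infty$ for all $\lambda>0$; it is normalized if it is $C^1$ and $L'(x)=o(L(x)/x)$. A renormalization function is $B(x)=x^dL(x)$ with $d>0$ and $L$ a normalized slowly varying function. Convergence with tight maxima: $S_n/B_n$ converges with tight maxima to $\mathcal{W}$ if $S_n/B_n$ converges in law to $\mathcal{W}$ and the sequence $(\max_{1\le k\le n}|S_k|)/B_n$, $n\ge1$, is tight. In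 the theorem it is applied to $S_n^Yf_Y$ and the sequence $B_n=B(n/m(Y))$. *)

theory Defs
  imports "HOL-Probability.Probability"
begin

definition measure_preserving_map :: "'a measure \<Rightarrow> ('a \<Rightarrow> 'a) \<Rightarrow> bool" where
  "measure_preserving_map M T \<longleftrightarrow> T \<in> measurable M M \<and> distr M M T = M"

definition ergodic_endomorphism :: "'a measure \<Rightarrow> ('a \<Rightarrow> 'a) \<Rightarrow> bool" where
  "ergodic_endomorphism M T \<longleftrightarrow> measure_preserving_map M T \<and>
     (\<forall>A\<in>sets M. T -` A \<inter> space M = A \<longrightarrow> measure M A = 0 \<or> measure M A = measure M (space M))"

definition birkhoff_sum :: "('a \<Rightarrow> 'a) \<Rightarrow> nat \<Rightarrow> ('a \<Rightarrow> real) \<Rightarrow> 'a \<Rightarrow> real" where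
  "birkhoff_sum T n f x = (\<Sum>k<n. f ((T ^^ k) x))"

text \<open>
  For a point that never returns to \<open>Y\<close> the infimum below is the one of the empty set, which is
  \<open>0\<close> on natural numbers: the induced map then fixes the point. In the situation of interest
  almost every point of \<open>Y\<close> returns, so this convention only concerns a null set.
\<close>

definition return_time :: "('a \<Rightarrow> 'a) \<Rightarrow> 'a set \<Rightarrow> 'a \<Rightarrow> nat" where
  "return_time T Y y = Inf {n. 0 < n \<and> (T ^^ n) y \<in> Y}"

text \<open>
  The induced map is only meaningful on \<open>Y\<close>; the formula is used on the whole type because
  the maps are total. The measure \<open>uniform_measure M Y\<close>, which is \<open>A \<mapsto> m(Y \<inter> A) / m(Y)\<close>, plays
  the role of \<open>m\<^sub>Y\<close>; it gives no mass to the complement of \<open>Y\<close>.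
\<close>

definition induced_map :: "('a \<Rightarrow> 'a) \<Rightarrow> 'a set \<Rightarrow> 'a \<Rightarrow> 'a" where
  "induced_map T Y y = (T ^^ return_time T Y y) y"

definition induced_fun :: "('a \<Rightarrow> 'a) \<Rightarrow> 'a set \<Rightarrow> ('a \<Rightarrow> real) \<Rightarrow> 'a \<Rightarrow> real" where
  "induced_fun T Y f y = (if y \<in> Y then \<Sum>k<return_time T Y y. f ((T ^^ k) y) else 0)"

text \<open>Only the values of the following functions on \<open>(0, \<infinity>)\<close> matter.\<close>

definition slowly_varying :: "(real \<Rightarrow> real) \<Rightarrow> bool" where
  "slowly_varying L \<longleftrightarrow> continuous_on {0<..} L \<and> (\<forall>x>0. 0 < L x) \<and>
     (\<forall>c>0. ((\<lambda>x. L (c * x) / L x) \<longlongrightarrow> 1) at_top)"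

definition normalized_slowly_varying :: "(real \<Rightarrow> real) \<Rightarrow> bool" where
  "normalized_slowly_varying L \<longleftrightarrow> slowly_varying L \<and>
     L differentiable_on {0<..} \<and> continuous_on {0<..} (deriv L) \<and>
     deriv L \<in> o[at_top](\<lambda>x. L x / x)"

definition renormalization_function :: "(real \<Rightarrow> real) \<Rightarrow> bool" where
  "renormalization_function B \<longleftrightarrow>
     (\<exists>d>0. \<exists>L. normalized_slowly_varying L \<and> (\<forall>x>0. B x = x powr d * L x))"

text \<open>
  The limit random variable \<open>W\<close> lives on its own probability space \<open>P\<close>.
\<close>

definition converges_in_law ::
  "'a measure \<Rightarrow> (nat \<Rightarrow> 'a \<Rightarrow> real) \<Rightarrow> 'b measure \<Rightarrow> ('b \<Rightarrow> real) \<Rightarrow> bool" where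
  "converges_in_law M Z P W \<longleftrightarrow> weak_conv_m (\<lambda>n. distr M borel (Z n)) (distr P borel W)"

text \<open>
  Tightness is required of the normalized maxima with index \<open>n \<ge> 1\<close>, whence the shift by \<open>Suc\<close>.
\<close>

definition converges_with_tight_maxima ::
  "'a measure \<Rightarrow> (nat \<Rightarrow> 'a \<Rightarrow> real) \<Rightarrow> (nat \<Rightarrow> real) \<Rightarrow> 'b measure \<Rightarrow> ('b \<Rightarrow> real) \<Rightarrow> bool" where
  "converges_with_tight_maxima M S b P W \<longleftrightarrow>
     converges_in_law M (\<lambda>n x. S n x / b n) P W \<and>
     tight (\<lambda>n. distr M borel (\<lambda>x. (MAX k\<in>{1..Suc n}. \<bar>S k x\<bar>) / b (Suc n)))"

end

theory Submission
  imports Defs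
begin

text \<open>
  Write \<open>p = m(Y)\<close>. Starting from a point of \<open>Y\<close>, the sum \<open>S\<^sub>n f\<close> is the induced sum \<open>S\<^sub>N\<^sup>Y f\<^sub>Y\<close>, where \<open>N\<close>
  counts the returns up to time \<open>n\<close>, plus the sum over an unfinished excursion. The latter is tight,
  because the excursions in progress at time \<open>n\<close> have total mass at most \<open>1\<close> uniformly in \<open>n\<close>. By the
  ergodic theorem \<open>N\<close> is within \<open>\<delta>n\<close> of \<open>np\<close>, and by invariance of \<open>m\<^sub>Y\<close> the change of the induced sum
  over such a window is at most twice a maximum over \<open>2\<delta>n\<close> steps, hence of order \<open>B(2\<delta>n/p)\<close>, which is
  small compared to \<open>B(n)\<close>. This gives the convergence for \<open>m\<^sub>Y\<close>. Since \<open>S\<^sub>n f \<circ> T - S\<^sub>n f\<close> is negligible, in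
  the integral of \<open>exp(itS\<^sub>n f/B(n))\<close> over \<open>Y\<close> the indicator of \<open>Y\<close> may be replaced by its ergodic averages,
  that is by the constant \<open>p\<close>, which transfers the convergence from \<open>m\<^sub>Y\<close> to \<open>m\<close>.
\<close>

subsection \<open>The ergodic theorem\<close>

lemma birkhoff_sum_0 [simp]: "birkhoff_sum T 0 f x = 0"
  by (simp add: birkhoff_sum_def)

lemma birkhoff_sum_add:
  "birkhoff_sum T (m + n) f x = birkhoff_sum T m f x + birkhoff_sum T n f ((T ^^ m) x)"
proof -
  have "(\<Sum>k\<in>{m..<m+n}. f ((T ^^ k) x)) = (\<Sum>k<n. f ((T ^^ k) ((T ^^ m) x)))"
    using sum.shift_bounds_nat_ivl[of "\<lambda>k. f ((T ^^ k) x)" 0 m n]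
    by (simp add: funpow_add add.commute atLeast0LessThan)
  then show ?thesis
    unfolding birkhoff_sum_def
    using sum.atLeastLessThan_concat[of 0 m "m+n" "\<lambda>k. f ((T ^^ k) x)"]
    by (simp add: atLeast0LessThan)
qed

lemma birkhoff_sum_Suc:
  "birkhoff_sum T (Suc n) f x = birkhoff_sum T n f x + f ((T ^^ n) x)"
  by (simp add: birkhoff_sum_def)

lemma birkhoff_sum_Suc_shift:
  "birkhoff_sum T (Suc n) f x = f x + birkhoff_sum T n f (T x)"
  using birkhoff_sum_add[of T 1 n f x] by (simp add: birkhoff_sum_def)

lemma birkhoff_sum_diff_const:
  "birkhoff_sum T n (\<lambda>x. g x - c) x = birkhoff_sum T n g x - real n * c"
  by (simp add: birkhoff_sum_def sum_subtractf)

lemma birkhoff_sum_uminus: "birkhoff_sum T n (\<lambda>x. - g x) x = - birkhoff_sum T n g x"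
  by (simp add: birkhoff_sum_def sum_negf)

lemma birkhoff_sum_indicator_bounds:
  "0 \<le> birkhoff_sum T n (indicator A) x" "birkhoff_sum T n (indicator A) x \<le> real n"
proof -
  have "birkhoff_sum T n (indicator A) x \<le> (\<Sum>k<n. 1)"
    unfolding birkhoff_sum_def by (intro sum_mono) (auto simp: indicator_def)
  then show "birkhoff_sum T n (indicator A) x \<le> real n" by simp
qed (auto simp: birkhoff_sum_def intro!: sum_nonneg)

lemma funpow_funpow: "(T ^^ m) ((T ^^ n) x) = (T ^^ (m + n)) x"
  by (simp add: funpow_add)

section \<open>Measure-preserving maps of a probability space\<close>

locale pmp = prob_space M for M :: "'a measure" +
  fixes T :: "'a \<Rightarrow> 'a"
  assumes measure_preserving: "measure_preserving_map M T"
begin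

lemma T_measurable [measurable]: "T \<in> measurable M M"
  and distr_T: "distr M M T = M"
  using measure_preserving by (auto simp: measure_preserving_map_def)

lemma funpow_measurable [measurable]: "(T ^^ n) \<in> measurable M M"
  by (induction n) (auto simp: measurable_comp)

lemma distr_funpow: "distr M M (T ^^ n) = M"
proof (induction n)
  case (Suc n)
  have "distr M M (T ^^ Suc n) = distr (distr M M (T ^^ n)) M T"
    by (subst distr_distr) (auto simp: comp_def)
  then show ?case using Suc distr_T by (metis)
qed (simp add: distr_id[unfolded id_def] id_def)

lemma measure_funpow_vimage:
  assumes "A \<in> sets M"
  shows "measure M ((T ^^ n) -` A \<inter> space M) = measure M A"
  using measure_distr[of "T ^^ n" M M A] assms by (simp add: distr_funpow)

lemma integral_funpow:
  fixes g :: "'a \<Rightarrow> 'b :: {banach, second_countable_topology}"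
  assumes "g \<in> borel_measurable M"
  shows "(\<integral>x. g ((T ^^ n) x) \<partial>M) = (\<integral>x. g x \<partial>M)"
  using integral_distr[of "T ^^ n" M M g] assms by (simp add: distr_funpow)

lemma integrable_funpow:
  fixes g :: "'a \<Rightarrow> 'b :: {banach, second_countable_topology}"
  assumes "integrable M g"
  shows "integrable M (\<lambda>x. g ((T ^^ n) x))"
  using integrable_distr_eq[of "T ^^ n" M M g] assms by (simp add: distr_funpow)

lemmas integral_T = integral_funpow[where n = 1, simplified]
lemmas integrable_T = integrable_funpow[where n = 1, simplified]

lemma birkhoff_sum_measurable [measurable]:
  assumes [measurable]: "g \<in> borel_measurable M"
  shows "birkhoff_sum T n g \<in> borel_measurable M"
  unfolding birkhoff_sum_def[abs_def] by measurable

end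

text \<open>The recursion computes the maximum of the Birkhoff sums over \<open>0 \<le> k \<le> n\<close>.\<close>

primrec maximal_sum :: "('a \<Rightarrow> 'a) \<Rightarrow> ('a \<Rightarrow> real) \<Rightarrow> nat \<Rightarrow> 'a \<Rightarrow> real" where
  "maximal_sum T g 0 = (\<lambda>x. 0)"
| "maximal_sum T g (Suc n) = (\<lambda>x. max 0 (g x + maximal_sum T g n (T x)))"

lemma maximal_sum_nonneg: "0 \<le> maximal_sum T g n x"
  by (cases n) auto

lemma maximal_sum_mono: "maximal_sum T g n x \<le> maximal_sum T g (Suc n) x"
proof (induction n arbitrary: x)
  case (Suc n)
  then show ?case
    using Suc[of "T x"] by (subst (1 2) maximal_sum.simps(2)) (intro max.mono add_left_mono order_refl)
qed simp

lemma birkhoff_sum_le_maximal_sum: "birkhoff_sum T n g x \<le> maximal_sum T g n x"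
proof (induction n arbitrary: x)
  case (Suc n)
  then show ?case
    using Suc[of "T x"] by (auto simp: birkhoff_sum_Suc_shift intro!: max.coboundedI2)
qed simp

section \<open>The maximal ergodic theorem\<close>

context pmp
begin

lemma integrable_maximal_sum:
  assumes "integrable M g"
  shows "integrable M (maximal_sum T g n)"
proof (induction n)
  case (Suc n)
  have "integrable M (\<lambda>x. g x + maximal_sum T g n (T x))"
    using assms integrable_T[OF Suc] by auto
  then show ?case by auto
qed simp

text \<open>Garsia's argument: where the maximal sum of order \<open>Suc n\<close> is positive, it
  is \<open>g x\<close> plus the maximal sum of order \<open>n\<close> at \<open>T x\<close>, so it
  exceeds its own value at \<open>T x\<close> by at most \<open>g x\<close>; elsewhere it is zero
  and the difference is not positive. By invariance the difference has integral zero.\<close>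

lemma maximal_ergodic:
  assumes g: "integrable M g" and pos: "AE x in M. \<exists>n. 0 < birkhoff_sum T n g x"
  shows "0 \<le> (\<integral>x. g x \<partial>M)"
proof -
  let ?m = "maximal_sum T g"
  have [measurable]: "g \<in> borel_measurable M" "?m n \<in> borel_measurable M" for n
    using g integrable_maximal_sum[OF g] by auto
  define G where "G n x = g x * indicator {x. 0 < ?m (Suc n) x} x" for n x
  have le: "?m (Suc n) x - ?m (Suc n) (T x) \<le> G n x" for n x
    using maximal_sum_mono[of T g n "T x"] maximal_sum_nonneg[of T g "Suc n" "T x"]
      maximal_sum_nonneg[of T g n "T x"]
    by (auto simp: G_def indicator_def max_def)
  have int_G: "integrable M (G n)" for n
    by (rule Bochner_Integration.integrable_bound[OF g])
      (auto simp: G_def[abs_def] indicator_def simp del: maximal_sum.simps)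
  have G_nonneg: "0 \<le> (\<integral>x. G n x \<partial>M)" for n
  proof -
    have "(\<integral>x. ?m (Suc n) x - ?m (Suc n) (T x) \<partial>M) = 0"
      using integrable_maximal_sum[OF g, of "Suc n"] integrable_T[of "?m (Suc n)"]
        integral_T[of "?m (Suc n)"] by (simp del: maximal_sum.simps)
    moreover have "(\<integral>x. ?m (Suc n) x - ?m (Suc n) (T x) \<partial>M) \<le> (\<integral>x. G n x \<partial>M)"
      using integrable_maximal_sum[OF g, of "Suc n"] integrable_T[of "?m (Suc n)"] int_G le
      by (intro integral_mono) (auto simp del: maximal_sum.simps)
    ultimately show ?thesis by simp
  qed
  \<comment> \<open>By \<open>pos\<close>, the sets where the maximal sums are positive increase to
    almost the whole space.\<close>
  have "(\<lambda>n. \<integral>x. G n x \<partial>M) \<longlonglongrightarrow> (\<integral>x. g x \<partial>M)"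
  proof (rule integral_dominated_convergence[where w = "\<lambda>x. \<bar>g x\<bar>"])
    show "AE x in M. (\<lambda>n. G n x) \<longlonglongrightarrow> g x"
      using pos
    proof eventually_elim
      case (elim x)
      then obtain n where n: "0 < birkhoff_sum T n g x" by blast
      have "G k x = g x" if "k \<ge> n" for k
      proof -
        have "?m n x \<le> ?m (Suc k) x"
          using that lift_Suc_mono_le[of "\<lambda>n. ?m n x" n "Suc k"] maximal_sum_mono[of T g _ x]
          by (simp del: maximal_sum.simps)
        then show ?thesis
          using n birkhoff_sum_le_maximal_sum[of T n g x]
          by (auto simp: G_def indicator_def simp del: maximal_sum.simps)
      qed
      then show ?case
        by (intro tendsto_eventually) (auto simp: eventually_sequentially)
    qed
  qed (use g int_G in \<open>auto simp: G_def indicator_def simp del: maximal_sum.simps\<close>)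
  then show ?thesis
    using G_nonneg by (intro LIMSEQ_le_const) auto
qed

end

section \<open>Birkhoff's theorem for ergodic maps\<close>

locale ergodic_pmp = pmp +
  assumes ergodic: "ergodic_endomorphism M T"
begin

lemma invariant_set_trivial:
  assumes "A \<in> sets M" "T -` A \<inter> space M = A"
  shows "measure M A = 0 \<or> measure M A = 1"
  using ergodic assms prob_space by (auto simp: ergodic_endomorphism_def)

text \<open>Unboundedness from above, unlike positivity, is exactly \<open>T\<close>-invariant.\<close>

lemma birkhoff_sum_bounded_above:
  assumes g: "integrable M g" and neg: "(\<integral>x. g x \<partial>M) < 0"
  shows "AE x in M. \<exists>K::nat. \<forall>n. birkhoff_sum T n g x \<le> real K"
proof -
  have [measurable]: "g \<in> borel_measurable M" using g by auto
  define A where "A = {x\<in>space M. \<forall>K::nat. \<exists>n. real K < birkhoff_sum T n g x}"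
  have [measurable]: "A \<in> sets M" unfolding A_def by measurable
  have "x \<in> A \<longleftrightarrow> T x \<in> A" if x: "x \<in> space M" for x
  proof -
    have Tx: "T x \<in> space M" using x measurable_space[OF T_measurable] by auto
    have "(\<forall>K::nat. \<exists>n. real K < birkhoff_sum T n g x) \<longleftrightarrow>
      (\<forall>K::nat. \<exists>n. real K < birkhoff_sum T n g (T x))" (is "?l \<longleftrightarrow> ?r")
    proof
      assume l: ?l
      show ?r
      proof
        fix K :: nat
        \<comment> \<open>Passing between \<open>x\<close> and \<open>T x\<close> costs at most
          \<open>|g x|\<close>, which the higher level \<open>L\<close> absorbs; since
          \<open>L\<close> is positive, it also rules out \<open>n = 0\<close>.\<close>
        obtain L :: nat where L: "real K + \<bar>g x\<bar> < real L" using reals_Archimedean2 by blast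
        obtain n where n: "real L < birkhoff_sum T n g x" using l by blast
        with L obtain k where "n = Suc k" by (cases n) auto
        with n L show "\<exists>n. real K < birkhoff_sum T n g (T x)"
          by (intro exI[of _ k]) (auto simp: birkhoff_sum_Suc_shift)
      qed
    next
      assume r: ?r
      show ?l
      proof
        fix K :: nat
        obtain L :: nat where L: "real K + \<bar>g x\<bar> < real L" using reals_Archimedean2 by blast
        obtain n where n: "real L < birkhoff_sum T n g (T x)" using r by blast
        with L show "\<exists>n. real K < birkhoff_sum T n g x"
          by (intro exI[of _ "Suc n"]) (auto simp: birkhoff_sum_Suc_shift)
      qed
    qed
    then show ?thesis using x Tx by (simp add: A_def)
  qed
  then have "T -` A \<inter> space M = A"
    unfolding A_def by blast
  then consider "measure M A = 0" | "measure M A = 1"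
    using invariant_set_trivial[of A] by auto
  then show ?thesis
  proof cases
    case 1
    then have "AE x in M. x \<notin> A" by (simp add: prob_eq_0)
    then show ?thesis
      by (rule AE_mp) (auto simp: A_def not_less intro!: AE_I2)
  next
    \<comment> \<open>Unbounded sums are positive at some time, so the maximal ergodic theorem would
      make the integral nonnegative.\<close>
    case 2
    then have "AE x in M. x \<in> A" by (simp add: AE_in_set_eq_1)
    then have "AE x in M. \<exists>n. 0 < birkhoff_sum T n g x"
    proof eventually_elim
      case (elim x)
      then have "\<exists>n. real 0 < birkhoff_sum T n g x" unfolding A_def by blast
      then show ?case by simp
    qed
    with neg maximal_ergodic[OF g] show ?thesis by auto
  qed
qed

text \<open>After subtraction of a constant \<open>?c\<close> just above the mean, the integral is
  negative and the sums stay bounded above; division by \<open>n\<close> removes this bound.\<close>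

lemma birkhoff_upper:
  assumes g: "integrable M g" and e: "0 < e"
  shows "AE x in M. \<forall>\<^sub>F n in sequentially. birkhoff_sum T n g x / real n < (\<integral>x. g x \<partial>M) + e"
proof -
  let ?c = "(\<integral>x. g x \<partial>M) + e / 2"
  have "AE x in M. \<exists>K::nat. \<forall>n. birkhoff_sum T n (\<lambda>x. g x - ?c) x \<le> real K"
    using g e by (intro birkhoff_sum_bounded_above) (auto simp: prob_space)
  then show ?thesis
  proof eventually_elim
    case (elim x)
    then obtain K :: nat where K: "\<And>n. birkhoff_sum T n g x \<le> real n * ?c + real K"
      by (auto simp: birkhoff_sum_diff_const algebra_simps)
    obtain N :: nat where N: "real K * 2 / e < real N" using reals_Archimedean2 by blast
    show ?case
    proof (rule eventually_sequentiallyI[of "Suc N"])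
      fix n assume n: "n \<ge> Suc N"
      then have "real K * 2 / e < real n" using N by linarith
      then have "real K < real n * (e / 2)" using e by (simp add: field_simps)
      then have "birkhoff_sum T n g x < real n * ((\<integral>x. g x \<partial>M) + e)"
        using K[of n] by (simp add: algebra_simps)
      then show "birkhoff_sum T n g x / real n < (\<integral>x. g x \<partial>M) + e"
        using n by (simp add: field_simps)
    qed
  qed
qed

text \<open>The two one-sided bounds come from \<open>birkhoff_upper\<close> for \<open>g\<close>
  and for \<open>- g\<close>. With tolerances \<open>1 / Suc k\<close>, only countably many null
  sets have to be discarded.\<close>

theorem birkhoff:
  assumes g: "integrable M g"
  shows "AE x in M. (\<lambda>n. birkhoff_sum T n g x / real n) \<longlonglongrightarrow> (\<integral>x. g x \<partial>M)"
proof -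
  let ?I = "\<integral>x. g x \<partial>M"
  have "AE x in M. \<forall>k::nat.
      (\<forall>\<^sub>F n in sequentially. birkhoff_sum T n g x / real n < ?I + 1 / real (Suc k)) \<and>
      (\<forall>\<^sub>F n in sequentially. ?I - 1 / real (Suc k) < birkhoff_sum T n g x / real n)"
  proof (subst AE_all_countable, intro allI)
    fix k :: nat
    have "AE x in M. \<forall>\<^sub>F n in sequentially. birkhoff_sum T n g x / real n < ?I + 1 / real (Suc k)"
      using g by (intro birkhoff_upper) auto
    moreover have "AE x in M. \<forall>\<^sub>F n in sequentially.
        birkhoff_sum T n (\<lambda>x. - g x) x / real n < (\<integral>x. - g x \<partial>M) + 1 / real (Suc k)"
      using g by (intro birkhoff_upper) auto
    ultimately show "AE x in M.
      (\<forall>\<^sub>F n in sequentially. birkhoff_sum T n g x / real n < ?I + 1 / real (Suc k)) \<and>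
      (\<forall>\<^sub>F n in sequentially. ?I - 1 / real (Suc k) < birkhoff_sum T n g x / real n)"
    proof eventually_elim
      case (elim x)
      have "\<forall>\<^sub>F n in sequentially. ?I - 1 / real (Suc k) < birkhoff_sum T n g x / real n"
        using elim(2) by (rule eventually_mono) (simp add: birkhoff_sum_uminus)
      with elim(1) show ?case by blast
    qed
  qed
  then show ?thesis
  proof eventually_elim
    case (elim x)
    show ?case
    proof (rule order_tendstoI)
      fix a assume "a < ?I"
      then obtain k where "1 / real (Suc k) < ?I - a"
        using reals_Archimedean[of "?I - a"] by (auto simp: inverse_eq_divide)
      then have k: "a < ?I - 1 / real (Suc k)" by linarith
      show "\<forall>\<^sub>F n in sequentially. a < birkhoff_sum T n g x / real n"
        using elim[rule_format, THEN conjunct2, of k] by (rule eventually_mono) (use k in linarith)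
    next
      fix a assume "?I < a"
      then obtain k where "1 / real (Suc k) < a - ?I"
        using reals_Archimedean[of "a - ?I"] by (auto simp: inverse_eq_divide)
      then have k: "?I + 1 / real (Suc k) < a" by linarith
      show "\<forall>\<^sub>F n in sequentially. birkhoff_sum T n g x / real n < a"
        using elim[rule_format, THEN conjunct1, of k] by (rule eventually_mono) (use k in linarith)
    qed
  qed
qed

text \<open>The averages lie between 0 and 1, so dominated convergence applies. This mean form
  serves to replace an indicator by a constant and, through Markov's inequality, to control the
  frequency of visits.\<close>

lemma mean_ergodic_indicator:
  assumes [measurable]: "A \<in> sets M"
  shows "(\<lambda>n. \<integral>x. \<bar>birkhoff_sum T n (indicator A) x / real n - measure M A\<bar> \<partial>M) \<longlonglongrightarrow> 0"
proof -
  have int: "integrable M (indicator A :: 'a \<Rightarrow> real)"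
    by (intro integrable_real_indicator) (auto simp: less_top[symmetric])
  have *: "0 \<le> birkhoff_sum T n (indicator A) x / real n"
    "birkhoff_sum T n (indicator A) x / real n \<le> 1" for n x
    using birkhoff_sum_indicator_bounds[of T n A x] by (auto simp: divide_le_eq_1)
  have "(\<lambda>n. \<integral>x. \<bar>birkhoff_sum T n (indicator A) x / real n - measure M A\<bar> \<partial>M)
      \<longlonglongrightarrow> (\<integral>x. 0 \<partial>M)"
  proof (rule integral_dominated_convergence[where w = "\<lambda>_. 1"])
    show "AE x in M. (\<lambda>n. \<bar>birkhoff_sum T n (indicator A) x / real n - measure M A\<bar>) \<longlonglongrightarrow> 0"
      using birkhoff[OF int]
    proof eventually_elim
      case (elim x)
      then have "(\<lambda>n. birkhoff_sum T n (indicator A) x / real n) \<longlonglongrightarrow> measure M A"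
        by simp
      from tendsto_diff[OF this tendsto_const, of "measure M A"] show ?case
        by (simp add: tendsto_rabs_zero)
    qed
    show "AE x in M. norm \<bar>birkhoff_sum T n (indicator A) x / real n - measure M A\<bar> \<le> 1" for n
    proof (rule AE_I2)
      fix x
      show "norm \<bar>birkhoff_sum T n (indicator A) x / real n - measure M A\<bar> \<le> 1"
        using *[of n x] measure_nonneg[of M A] prob_le_1[of A] unfolding real_norm_def by linarith
    qed
  qed auto
  then show ?thesis by simp
qed

end

subsection \<open>Renormalization functions\<close>

locale renormalization =
  fixes B L :: "real \<Rightarrow> real" and d :: real
  assumes d_pos: "0 < d" and L: "normalized_slowly_varying L"
    and B_eq: "\<And>x. 0 < x \<Longrightarrow> B x = x powr d * L x"
begin

lemma L_pos: "0 < x \<Longrightarrow> 0 < L x"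
  using L by (auto simp: normalized_slowly_varying_def slowly_varying_def)

lemma B_pos: "0 < x \<Longrightarrow> 0 < B x"
  by (simp add: B_eq L_pos)

text \<open>This is the only place where normalization, and not just slow variation, is used.\<close>

lemma powr_L_eventually_mono:
  assumes a: "0 < a"
  shows "\<exists>x0>0. mono_on {x0..} (\<lambda>x. x powr a * L x)"
proof -
  \<comment> \<open>The constant in the little-o bound is taken to be \<open>a\<close>, so that
    \<open>a * L z + z * deriv L z\<close>, the sign-bearing factor of the derivative, is
    nonnegative.\<close>
  have "\<forall>\<^sub>F x in at_top. norm (deriv L x) \<le> a * norm (L x / x)"
    using L a landau_o.smallD[of "deriv L" at_top "\<lambda>x. L x / x"]
    by (auto simp: normalized_slowly_varying_def)
  then obtain x1 where x1: "\<And>x. x1 \<le> x \<Longrightarrow> norm (deriv L x) \<le> a * norm (L x / x)"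
    by (auto simp: eventually_at_top_linorder)
  have diff: "(L has_real_derivative deriv L x) (at x)" if "0 < x" for x
  proof -
    have "L differentiable (at x within {0<..})"
      using L that by (auto simp: normalized_slowly_varying_def differentiable_on_def)
    moreover have "at x within {0<..} = at x" using that by (intro at_within_open) auto
    ultimately show ?thesis by (simp add: DERIV_deriv_iff_real_differentiable)
  qed
  define x0 where "x0 = max 1 x1"
  have "x powr a * L x \<le> y powr a * L y" if "x0 \<le> x" "x \<le> y" for x y
  proof (rule DERIV_nonneg_imp_nondecreasing[OF that(2)])
    fix z assume "x \<le> z" "z \<le> y"
    then have z: "0 < z" "x1 \<le> z" using that by (auto simp: x0_def)
    have "((\<lambda>x. x powr a * L x) has_real_derivative a * z powr (a - 1) * L z + z powr a * deriv L z) (at z)"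
      using z by (auto intro!: derivative_eq_intros diff)
    moreover have "0 \<le> a * z powr (a - 1) * L z + z powr a * deriv L z"
    proof -
      have "- deriv L z \<le> a * (L z / z)"
        using x1[OF z(2)] z L_pos[OF z(1)] by (auto simp: abs_le_iff)
      then have "z powr a * (- deriv L z) \<le> z powr a * (a * (L z / z))"
        by (intro mult_left_mono) auto
      also have "\<dots> = a * z powr (a - 1) * L z"
        using z by (simp add: powr_diff)
      finally show ?thesis by simp
    qed
    ultimately show "\<exists>D. ((\<lambda>x. x powr a * L x) has_real_derivative D) (at z) \<and> 0 \<le> D" by blast
  qed
  then show ?thesis
    by (intro exI[of _ x0]) (auto simp: x0_def mono_on_def)
qed

lemma B_eventually_mono: "\<exists>x0>0. mono_on {x0..} B"
proof -
  obtain x0 where x0: "0 < x0" "mono_on {x0..} (\<lambda>x. x powr d * L x)"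
    using powr_L_eventually_mono[OF d_pos] by blast
  then have "mono_on {x0..} B"
    by (simp add: mono_on_def B_eq)
  with x0 show ?thesis by blast
qed

text \<open>Write \<open>B x\<close> as \<open>x powr (d / 2)\<close> times
  \<open>x powr (d / 2) * L x\<close>: the second factor is eventually nondecreasing, hence bounded
  below by a positive constant.\<close>

lemma B_at_top: "filterlim B at_top at_top"
proof -
  obtain x0 where x0: "0 < x0" "mono_on {x0..} (\<lambda>x. x powr (d / 2) * L x)"
    using powr_L_eventually_mono[of "d / 2"] d_pos by auto
  define c where "c = x0 powr (d / 2) * L x0"
  have c: "0 < c" using x0 L_pos by (simp add: c_def)
  have "filterlim (\<lambda>x. exp (d / 2 * ln x)) at_top at_top"
    using d_pos by (intro filterlim_compose[OF exp_at_top]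
        filterlim_tendsto_pos_mult_at_top[OF tendsto_const] ln_at_top) auto
  then have "filterlim (\<lambda>x. x powr (d / 2)) at_top at_top"
    by (rule filterlim_at_top_mono)
      (auto simp: powr_def intro!: eventually_mono[OF eventually_gt_at_top[of 0]])
  then have "filterlim (\<lambda>x. c * x powr (d / 2)) at_top at_top"
    using c by (intro filterlim_tendsto_pos_mult_at_top[OF tendsto_const]) auto
  moreover have "\<forall>\<^sub>F x in at_top. c * x powr (d / 2) \<le> B x"
    using eventually_ge_at_top[of x0]
  proof eventually_elim
    case (elim x)
    then have "c \<le> x powr (d / 2) * L x"
      using x0 by (auto simp: c_def mono_on_def)
    then have "c * x powr (d / 2) \<le> (x powr (d / 2) * L x) * x powr (d / 2)"
      by (intro mult_right_mono) auto
    also have "\<dots> = B x"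
      using elim x0 by (simp add: B_eq powr_add[symmetric] mult_ac flip: mult.assoc)
    finally show ?case .
  qed
  ultimately show ?thesis by (rule filterlim_at_top_mono)
qed

lemma B_ratio:
  assumes c: "0 < c"
  shows "((\<lambda>x. B (c * x) / B x) \<longlongrightarrow> c powr d) at_top"
proof -
  have "((\<lambda>x. c powr d * (L (c * x) / L x)) \<longlongrightarrow> c powr d * 1) at_top"
    using L c by (intro tendsto_intros) (auto simp: normalized_slowly_varying_def slowly_varying_def)
  moreover have "\<forall>\<^sub>F x in at_top. c powr d * (L (c * x) / L x) = B (c * x) / B x"
    using eventually_gt_at_top[of 0]
  proof eventually_elim
    case (elim x)
    then show ?case using c L_pos[of x] by (simp add: B_eq powr_mult)
  qed
  ultimately show ?thesis by (auto intro: Lim_transform_eventually)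
qed

text \<open>The argument of \<open>B\<close> in the numerator is \<open>n\<close> up to a rounding
  loss of \<open>1 / p\<close>. Regular variation concerns fixed ratios only, so monotonicity is
  used to squeeze the value between \<open>B (c * n)\<close> and \<open>B n\<close> for each fixed
  \<open>c < 1\<close>, and then \<open>c\<close> approaches 1.\<close>

lemma B_floor_ratio:
  assumes p: "0 < p"
  shows "(\<lambda>n. B (real (nat \<lfloor>real n * p\<rfloor>) / p) / B (real n)) \<longlonglongrightarrow> 1"
proof -
  let ?u = "\<lambda>n::nat. real (nat \<lfloor>real n * p\<rfloor>) / p"
  obtain x0 where x0: "0 < x0" "mono_on {x0..} B"
    using B_eventually_mono by blast
  have u: "?u n \<le> real n" "real n - 1 / p \<le> ?u n" for n
  proof -
    define q where "q = real (nat \<lfloor>real n * p\<rfloor>)"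
    have "q = of_int \<lfloor>real n * p\<rfloor>" using p by (simp add: q_def)
    then have "q \<le> real n * p" "real n * p - 1 \<le> q"
      by linarith+
    moreover have "(real n - 1 / p) * p = real n * p - 1"
      using p by (simp add: left_diff_distrib)
    ultimately show "?u n \<le> real n" "real n - 1 / p \<le> ?u n"
      unfolding q_def[symmetric] using p by (simp_all add: pos_divide_le_eq pos_le_divide_eq)
  qed
  have lower: "\<forall>\<^sub>F n in sequentially. B (c * real n) / B (real n) \<le> B (?u n) / B (real n)
      \<and> B (?u n) / B (real n) \<le> 1" if c: "0 < c" "c < 1" for c
  proof -
    \<comment> \<open>The first bound puts \<open>c * n\<close> where \<open>B\<close> is monotone;
      the second makes \<open>(1 - c) * n\<close> exceed the rounding loss.\<close>
    obtain N :: nat where N: "max (x0 / c) (1 / (p * (1 - c))) < real N"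
      using reals_Archimedean2 by blast
    show ?thesis
    proof (rule eventually_sequentiallyI[of N])
      fix n assume "N \<le> n"
      then have n: "x0 / c < real n" "1 / (p * (1 - c)) < real n" using N by auto
      have n0: "0 < real n" using x0 c n(1) by (meson divide_pos_pos less_trans)
      have "x0 \<le> c * real n" using n c by (simp add: field_simps)
      moreover have "1 / p \<le> (1 - c) * real n" using n(2) c p by (simp add: field_simps)
      then have "c * real n \<le> ?u n" using u(2)[of n] by (simp add: algebra_simps)
      ultimately have "B (c * real n) \<le> B (?u n)" "B (?u n) \<le> B (real n)"
        using x0 u(1)[of n] by (auto simp: mono_on_def)
      then show "B (c * real n) / B (real n) \<le> B (?u n) / B (real n)
        \<and> B (?u n) / B (real n) \<le> 1"
        using B_pos[OF n0] by (auto simp: divide_right_mono)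
    qed
  qed
  show ?thesis
  proof (rule order_tendstoI)
    fix a :: real assume "1 < a"
    then show "\<forall>\<^sub>F n in sequentially. B (?u n) / B (real n) < a"
      using lower[of "1/2"] by (auto elim!: eventually_mono)
  next
    fix a :: real assume a: "a < 1"
    have "((\<lambda>c. c powr d) \<longlongrightarrow> 1 powr d) (at_left 1)"
      by (intro tendsto_intros) auto
    then have "\<forall>\<^sub>F c in at_left 1. a < c powr d"
      using a by (auto intro: order_tendstoD)
    moreover have "\<forall>\<^sub>F c in at_left (1::real). 0 < c \<and> c < 1"
      by (auto simp: eventually_at_left_field intro!: exI[of _ 0])
    ultimately have "\<forall>\<^sub>F c in at_left (1::real). a < c powr d \<and> 0 < c \<and> c < 1"
      by eventually_elim auto
    then obtain c where c: "a < c powr d" "0 < c" "c < 1"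
      using eventually_happens'[of "at_left (1::real)"] by auto
    have "(\<lambda>n. B (c * real n) / B (real n)) \<longlonglongrightarrow> c powr d"
      using filterlim_compose[OF B_ratio[OF c(2)] filterlim_real_sequentially] .
    then have "\<forall>\<^sub>F n in sequentially. a < B (c * real n) / B (real n)"
      using c(1) by (rule order_tendstoD)
    with lower[OF c(2,3)] show "\<forall>\<^sub>F n in sequentially. a < B (?u n) / B (real n)"
      by eventually_elim auto
  qed
qed

end

subsection \<open>Characteristic functions and convergence in probability\<close>

lemma iexp_Lipschitz: "cmod (iexp (t * x) - iexp (t * y)) \<le> \<bar>t\<bar> * \<bar>x - y\<bar>"
proof -
  have "iexp (t * x) - iexp (t * y) = iexp (t * y) * (iexp (t * (x - y)) - 1)"
    by (simp add: algebra_simps flip: exp_add)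
  then have "cmod (iexp (t * x) - iexp (t * y)) = cmod (iexp (t * (x - y)) - 1)"
    by (simp add: norm_mult)
  also have "\<dots> \<le> \<bar>t * (x - y)\<bar>"
    using iexp_approx1[of "t * (x - y)" 0] by simp
  finally show ?thesis by (simp add: abs_mult)
qed

text \<open>Tail estimates are obtained at integer levels \<open>K\<close>, whereas the thresholds
  in use form a real sequence \<open>b\<close>; this passes from the former to the latter.\<close>

lemma tendsto_0_along_at_top:
  assumes a: "a \<longlonglongrightarrow> (0::real)" and b: "filterlim b at_top sequentially"
    and le: "\<And>K n. real K \<le> b n \<Longrightarrow> c n \<le> a K" and nonneg: "\<And>n. 0 \<le> c n"
  shows "c \<longlonglongrightarrow> (0::real)"
proof (rule order_tendstoI)
  fix r :: real assume "0 < r"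
  with a obtain K where K: "a K < r"
    using order_tendstoD(2)[OF a, of r] by (auto simp: eventually_sequentially)
  have "\<forall>\<^sub>F n in sequentially. real K \<le> b n"
    using b by (auto simp: filterlim_at_top)
  then show "\<forall>\<^sub>F n in sequentially. c n < r"
    by eventually_elim (use le K in force)
qed (use nonneg in \<open>auto intro!: always_eventually intro: less_le_trans\<close>)

context prob_space
begin

lemma integrable_indicator_iexp:
  assumes [measurable]: "A \<in> events" "X \<in> borel_measurable M"
  shows "integrable M (\<lambda>x. indicator A x *\<^sub>R iexp (t * X x))"
  by (rule integrable_const_bound[of _ 1]) (auto simp: indicator_def)

text \<open>Slutsky's lemma for characteristic functions, restricted to \<open>A\<close>. Where
  \<open>X n\<close> and \<open>X' n\<close> are within \<open>e\<close> the Lipschitz bound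
  applies; on the remaining small event the integrands differ by at most 2.\<close>

lemma iexp_integral_diff_tendsto_0:
  fixes X X' :: "nat \<Rightarrow> 'a \<Rightarrow> real"
  assumes [measurable]: "A \<in> events" "\<And>n. X n \<in> borel_measurable M" "\<And>n. X' n \<in> borel_measurable M"
    and lim: "\<And>e. 0 < e \<Longrightarrow> (\<lambda>n. prob {x\<in>A. e < \<bar>X n x - X' n x\<bar>}) \<longlonglongrightarrow> 0"
  shows "(\<lambda>n. (\<integral>x. indicator A x *\<^sub>R iexp (t * X n x) \<partial>M) - (\<integral>x. indicator A x *\<^sub>R iexp (t * X' n x) \<partial>M))
    \<longlonglongrightarrow> 0"
proof (rule LIMSEQ_I)
  fix r :: real assume r: "0 < r"
  \<comment> \<open>The summand 1 in the denominator covers \<open>t = 0\<close>.\<close>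
  define e where "e = r / (2 * (\<bar>t\<bar> + 1))"
  have e: "0 < e" "\<bar>t\<bar> * e \<le> r / 2"
    using r by (auto simp: e_def field_simps)
  let ?E = "\<lambda>n. {x\<in>A. e < \<bar>X n x - X' n x\<bar>}"
  have E [measurable]: "?E n \<in> events" for n
  proof -
    have "?E n = {x\<in>space M. x \<in> A \<and> e < \<bar>X n x - X' n x\<bar>}"
      using sets.sets_into_space[OF assms(1)] by auto
    then show ?thesis by simp
  qed
  have bound: "norm ((\<integral>x. indicator A x *\<^sub>R iexp (t * X n x) \<partial>M) - (\<integral>x. indicator A x *\<^sub>R iexp (t * X' n x) \<partial>M))
      \<le> r / 2 + 2 * prob (?E n)" for n
  proof -
    have "(\<integral>x. indicator A x *\<^sub>R iexp (t * X n x) \<partial>M) - (\<integral>x. indicator A x *\<^sub>R iexp (t * X' n x) \<partial>M)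
      = (\<integral>x. indicator A x *\<^sub>R iexp (t * X n x) - indicator A x *\<^sub>R iexp (t * X' n x) \<partial>M)"
      by (intro Bochner_Integration.integral_diff[symmetric] integrable_indicator_iexp) auto
    also have "norm \<dots> \<le> (\<integral>x. r / 2 + 2 * indicator (?E n) x \<partial>M)"
    proof (rule order_trans[OF integral_norm_bound integral_mono])
      show "integrable M (\<lambda>x. r / 2 + 2 * indicator (?E n) x :: real)"
        by (intro Bochner_Integration.integrable_add integrable_mult_right integrable_real_indicator)
          (auto simp: less_top[symmetric])
      fix x assume "x \<in> space M"
      have 1: "norm (iexp (t * X n x) - iexp (t * X' n x)) \<le> \<bar>t\<bar> * \<bar>X n x - X' n x\<bar>"
        by (rule iexp_Lipschitz)
      have 2: "norm (iexp (t * X n x) - iexp (t * X' n x)) \<le> 2"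
        using norm_triangle_ineq4[of "iexp (t * X n x)" "iexp (t * X' n x)"] by simp
      show "norm (indicator A x *\<^sub>R iexp (t * X n x) - indicator A x *\<^sub>R iexp (t * X' n x))
          \<le> r / 2 + 2 * indicator (?E n) x"
      proof (cases "x \<in> ?E n")
        case True
        then show ?thesis using 2 r by (simp add: indicator_def)
      next
        case False
        then have "\<bar>t\<bar> * \<bar>X n x - X' n x\<bar> \<le> \<bar>t\<bar> * e" if "x \<in> A"
          using that by (intro mult_left_mono) auto
        with 1 e(2) r False show ?thesis by (auto simp: indicator_def)
      qed
    qed (intro integrable_norm Bochner_Integration.integrable_diff integrable_indicator_iexp; simp)
    also have "\<dots> = r / 2 + 2 * prob (?E n)"
    proof -
      have "integrable M (indicator (?E n) :: 'a \<Rightarrow> real)"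
        by (intro integrable_real_indicator) (auto simp: less_top[symmetric])
      then show ?thesis by (simp add: prob_space)
    qed
    finally show ?thesis .
  qed
  obtain N where N: "\<And>n. N \<le> n \<Longrightarrow> prob (?E n) < r / 4"
    using order_tendstoD(2)[OF lim[OF e(1)], of "r / 4"] r by (auto simp: eventually_sequentially)
  show "\<exists>no. \<forall>n\<ge>no. norm ((\<integral>x. indicator A x *\<^sub>R iexp (t * X n x) \<partial>M)
      - (\<integral>x. indicator A x *\<^sub>R iexp (t * X' n x) \<partial>M) - 0) < r"
  proof (intro exI[of _ N] allI impI)
    fix n assume "N \<le> n"
    then show "norm ((\<integral>x. indicator A x *\<^sub>R iexp (t * X n x) \<partial>M)
      - (\<integral>x. indicator A x *\<^sub>R iexp (t * X' n x) \<partial>M) - 0) < r"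
      using bound[of n] N[of n] by simp
  qed
qed

lemma prob_tail_tendsto_0:
  assumes [measurable]: "g \<in> borel_measurable M"
  shows "(\<lambda>K. prob {x\<in>space M. real K < \<bar>g x\<bar>}) \<longlonglongrightarrow> 0"
proof -
  have "(\<lambda>K. prob {x\<in>space M. real K < \<bar>g x\<bar>}) \<longlonglongrightarrow> prob (\<Inter>K. {x\<in>space M. real K < \<bar>g x\<bar>})"
    by (rule finite_Lim_measure_decseq) (auto simp: decseq_def)
  moreover have "(\<Inter>K. {x\<in>space M. real K < \<bar>g x\<bar>}) = {}"
  proof (rule equals0I)
    fix x assume x: "x \<in> (\<Inter>K. {x\<in>space M. real K < \<bar>g x\<bar>})"
    obtain K :: nat where "\<bar>g x\<bar> < real K" using reals_Archimedean2 by blast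
    moreover have "real K < \<bar>g x\<bar>" using x by blast
    ultimately show False by simp
  qed
  ultimately show ?thesis by (simp only: measure_empty)
qed

end

section \<open>Asymptotic invariance and asymptotic independence\<close>

context ergodic_pmp
begin

text \<open>If \<open>Z n\<close> is asymptotically \<open>T\<close>-invariant, then \<open>A\<close> may be replaced by any of its preimages, hence
  its indicator by an ergodic average.\<close>

lemma iexp_integral_asymp_indep:
  assumes [measurable]: "A \<in> events" "\<And>n. Z n \<in> borel_measurable M"
    and inv: "\<And>e. 0 < e \<Longrightarrow> (\<lambda>n. prob {x\<in>space M. e < \<bar>Z n (T x) - Z n x\<bar>}) \<longlonglongrightarrow> 0"
  shows "(\<lambda>n. (\<integral>x. indicator A x *\<^sub>R iexp (t * Z n x) \<partial>M) - prob A *\<^sub>R (\<integral>x. iexp (t * Z n x) \<partial>M)) \<longlonglongrightarrow> 0"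
proof -
  define J where "J j n = (\<integral>x. indicator A ((T ^^ j) x) *\<^sub>R iexp (t * Z n x) \<partial>M)" for j n
  have ind: "indicator A ((T ^^ j) x) = (indicator ((T ^^ j) -` A \<inter> space M) x :: real)"
    if "x \<in> space M" for j x
    using that by (auto simp: indicator_def)
  have [measurable]: "(T ^^ j) -` A \<inter> space M \<in> events" for j
    by (rule measurable_sets[OF funpow_measurable]) auto
  \<comment> \<open>By invariance of the measure, \<open>x\<close> may be replaced by
    \<open>T x\<close> in \<open>J j n\<close>. This turns the index \<open>j\<close> into
    \<open>Suc j\<close> and \<open>Z n\<close> into its composition with \<open>T\<close>, which is
    close to \<open>Z n\<close> in probability.\<close>
  have J_step: "(\<lambda>n. J j n - J (Suc j) n) \<longlonglongrightarrow> 0" for j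
  proof -
    let ?A = "(T ^^ Suc j) -` A \<inter> space M"
    have J1: "J j n = (\<integral>x. indicator ?A x *\<^sub>R iexp (t * Z n (T x)) \<partial>M)" for n
    proof -
      have "J j n = (\<integral>x. indicator A ((T ^^ j) (T x)) *\<^sub>R iexp (t * Z n (T x)) \<partial>M)"
        unfolding J_def by (rule integral_T[symmetric]) measurable
      also have "\<dots> = (\<integral>x. indicator ?A x *\<^sub>R iexp (t * Z n (T x)) \<partial>M)"
        by (intro Bochner_Integration.integral_cong refl)
          (auto simp: indicator_def funpow_swap1)
      finally show ?thesis .
    qed
    have J2: "J (Suc j) n = (\<integral>x. indicator ?A x *\<^sub>R iexp (t * Z n x) \<partial>M)" for n
      unfolding J_def by (intro Bochner_Integration.integral_cong refl) (simp add: ind del: funpow.simps)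
    show ?thesis
      unfolding J1 J2
    proof (rule iexp_integral_diff_tendsto_0)
      fix e :: real assume "0 < e"
      show "(\<lambda>n. prob {x\<in>?A. e < \<bar>Z n (T x) - Z n x\<bar>}) \<longlonglongrightarrow> 0"
        by (rule tendsto_sandwich[OF _ _ tendsto_const inv[OF \<open>0 < e\<close>]])
          (auto intro!: always_eventually finite_measure_mono)
    qed measurable
  qed
  have J: "(\<lambda>n. J 0 n - J j n) \<longlonglongrightarrow> 0" for j
  proof (induction j)
    case (Suc j)
    from tendsto_add[OF Suc J_step[of j]] show ?case by (simp add: algebra_simps)
  qed simp
  \<comment> \<open>For fixed \<open>N\<close>, integrals weighted by \<open>w N\<close> are
    asymptotically equal to \<open>J 0 n\<close>, being averages of \<open>J j n\<close> over
    \<open>j < N\<close>.\<close>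
  define w where "w N x = birkhoff_sum T N (indicator A) x / real N" for N x
  have [measurable]: "w N \<in> borel_measurable M" for N
    unfolding w_def[abs_def] by measurable
  have w_le: "\<bar>w N x\<bar> \<le> 1" for N x
    using birkhoff_sum_indicator_bounds[of T N A x] by (auto simp: w_def divide_le_eq_1)
  have int_iexp: "integrable M (\<lambda>x. iexp (t * Z n x))" for n
    by (rule integrable_const_bound[of _ 1]) auto
  have int_J: "integrable M (\<lambda>x. indicator A ((T ^^ j) x) *\<^sub>R iexp (t * Z n x))" for j n
    by (rule integrable_const_bound[of _ 1]) (auto simp: indicator_def)
  have int_w: "integrable M (\<lambda>x. w N x *\<^sub>R iexp (t * Z n x))" for N n
    by (rule integrable_const_bound[of _ 1]) (auto simp: w_le)
  have avg: "(\<integral>x. w N x *\<^sub>R iexp (t * Z n x) \<partial>M) = (1 / real N) *\<^sub>R (\<Sum>j<N. J j n)" for N n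
  proof -
    have "(\<integral>x. w N x *\<^sub>R iexp (t * Z n x) \<partial>M)
      = (\<integral>x. (1 / real N) *\<^sub>R (\<Sum>j<N. indicator A ((T ^^ j) x) *\<^sub>R iexp (t * Z n x)) \<partial>M)"
      by (simp add: w_def birkhoff_sum_def scaleR_sum_left divide_inverse mult.commute flip: scaleR_scaleR)
    also have "\<dots> = (1 / real N) *\<^sub>R (\<integral>x. (\<Sum>j<N. indicator A ((T ^^ j) x) *\<^sub>R iexp (t * Z n x)) \<partial>M)"
      by (rule integral_scaleR_right)
    also have "(\<integral>x. (\<Sum>j<N. indicator A ((T ^^ j) x) *\<^sub>R iexp (t * Z n x)) \<partial>M) = (\<Sum>j<N. J j n)"
      unfolding J_def by (rule Bochner_Integration.integral_sum) (rule int_J)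
    finally show ?thesis .
  qed
  have diff_avg: "(\<lambda>n. J 0 n - (\<integral>x. w N x *\<^sub>R iexp (t * Z n x) \<partial>M)) \<longlonglongrightarrow> 0" if "0 < N" for N
  proof -
    have "(\<lambda>n. (1 / real N) *\<^sub>R (\<Sum>j<N. J 0 n - J j n)) \<longlonglongrightarrow> (1 / real N) *\<^sub>R (\<Sum>j<N. 0)"
      by (intro tendsto_intros J)
    moreover have "(1 / real N) *\<^sub>R (\<Sum>j<N. J 0 n - J j n) = J 0 n - (\<integral>x. w N x *\<^sub>R iexp (t * Z n x) \<partial>M)" for n
      unfolding avg using that by (simp add: sum_subtractf scaleR_conv_of_real field_simps)
    ultimately show ?thesis by simp
  qed
  have bound: "norm ((\<integral>x. w N x *\<^sub>R iexp (t * Z n x) \<partial>M) - prob A *\<^sub>R (\<integral>x. iexp (t * Z n x) \<partial>M))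
    \<le> (\<integral>x. \<bar>w N x - prob A\<bar> \<partial>M)" for N n
  proof -
    have "(\<integral>x. w N x *\<^sub>R iexp (t * Z n x) \<partial>M) - prob A *\<^sub>R (\<integral>x. iexp (t * Z n x) \<partial>M)
      = (\<integral>x. (w N x - prob A) *\<^sub>R iexp (t * Z n x) \<partial>M)"
      using int_iexp[of n] int_w[of N n] by (simp add: scaleR_diff_left)
    also have "norm \<dots> \<le> (\<integral>x. norm ((w N x - prob A) *\<^sub>R iexp (t * Z n x)) \<partial>M)"
      by (rule integral_norm_bound)
    finally show ?thesis by simp
  qed
  show ?thesis
  proof (rule LIMSEQ_I)
    fix r :: real assume r: "0 < r"
    \<comment> \<open>The error made by replacing \<open>w N\<close> by its limit is bounded
      uniformly in \<open>n\<close>, so \<open>N\<close> can be fixed first and \<open>n\<close>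
      taken large afterwards.\<close>
    have "\<forall>\<^sub>F N in sequentially. (\<integral>x. \<bar>w N x - prob A\<bar> \<partial>M) < r / 2 \<and> 0 < N"
      using order_tendstoD(2)[OF mean_ergodic_indicator[OF assms(1)], of "r / 2"] r eventually_gt_at_top[of 0]
      by (auto simp: w_def eventually_conj)
    then obtain N where N: "(\<integral>x. \<bar>w N x - prob A\<bar> \<partial>M) < r / 2" "0 < N"
      using eventually_happens'[OF sequentially_bot] by blast
    obtain no where no: "\<And>n. no \<le> n \<Longrightarrow> norm (J 0 n - (\<integral>x. w N x *\<^sub>R iexp (t * Z n x) \<partial>M)) < r / 2"
      using LIMSEQ_D[OF diff_avg[OF N(2)], of "r / 2"] r by auto
    show "\<exists>no. \<forall>n\<ge>no. norm ((\<integral>x. indicator A x *\<^sub>R iexp (t * Z n x) \<partial>M)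
      - prob A *\<^sub>R (\<integral>x. iexp (t * Z n x) \<partial>M) - 0) < r"
    proof (intro exI[of _ no] allI impI)
      fix n assume "no \<le> n"
      have "norm (J 0 n - prob A *\<^sub>R (\<integral>x. iexp (t * Z n x) \<partial>M)) < r / 2 + r / 2"
        by (rule norm_diff_triangle_less[OF no[OF \<open>no \<le> n\<close>] le_less_trans[OF bound N(1)]])
      then show "norm ((\<integral>x. indicator A x *\<^sub>R iexp (t * Z n x) \<partial>M)
        - prob A *\<^sub>R (\<integral>x. iexp (t * Z n x) \<partial>M) - 0) < r"
        by (simp add: J_def)
    qed
  qed
qed

text \<open>The difference telescopes to \<open>f ((T ^^ n) x) - f x\<close>. If it exceeds
  \<open>e * b n\<close>, one of the two terms exceeds half of this, and both have the same
  law.\<close>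

lemma birkhoff_sum_asymp_invariant:
  assumes [measurable]: "f \<in> borel_measurable M"
    and b: "filterlim b at_top sequentially" and e: "0 < e"
  shows "(\<lambda>n. prob {x\<in>space M. e < \<bar>birkhoff_sum T n f (T x) / b n - birkhoff_sum T n f x / b n\<bar>}) \<longlonglongrightarrow> 0"
proof -
  define c where "c n = prob {x\<in>space M. e * b n / 2 < \<bar>f x\<bar>}" for n
  have c: "c \<longlonglongrightarrow> 0"
  proof (rule tendsto_0_along_at_top)
    show "(\<lambda>K. prob {x\<in>space M. real K < \<bar>f x\<bar>}) \<longlonglongrightarrow> 0"
      by (rule prob_tail_tendsto_0) measurable
    show "filterlim (\<lambda>n. (e / 2) * b n) at_top sequentially"
      using e b by (intro filterlim_tendsto_pos_mult_at_top[OF tendsto_const]) auto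
  qed (auto simp: c_def intro!: finite_measure_mono)
  have le: "\<forall>\<^sub>F n in sequentially.
    prob {x\<in>space M. e < \<bar>birkhoff_sum T n f (T x) / b n - birkhoff_sum T n f x / b n\<bar>} \<le> 2 * c n"
    using filterlim_at_top_dense[THEN iffD1, OF b, rule_format, of 0]
  proof eventually_elim
    case (elim n)
    let ?C = "{x\<in>space M. e * b n / 2 < \<bar>f x\<bar>}"
    have "prob {x\<in>space M. e < \<bar>birkhoff_sum T n f (T x) / b n - birkhoff_sum T n f x / b n\<bar>}
      \<le> prob (((T ^^ n) -` ?C \<inter> space M) \<union> ?C)"
    proof (intro finite_measure_mono subsetI)
      fix x assume x: "x \<in> {x\<in>space M. e < \<bar>birkhoff_sum T n f (T x) / b n - birkhoff_sum T n f x / b n\<bar>}"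
      have "birkhoff_sum T n f (T x) - birkhoff_sum T n f x = f ((T ^^ n) x) - f x"
        using birkhoff_sum_Suc[of T n f x] birkhoff_sum_Suc_shift[of T n f x] by simp
      then have "e < \<bar>f ((T ^^ n) x) - f x\<bar> / b n"
        using x elim by (simp flip: diff_divide_distrib)
      then have "e * b n < \<bar>f ((T ^^ n) x) - f x\<bar>" using elim by (simp add: field_simps)
      moreover have "x \<in> space M" "(T ^^ n) x \<in> space M"
        using x measurable_space[OF funpow_measurable] by auto
      ultimately show "x \<in> ((T ^^ n) -` ?C \<inter> space M) \<union> ?C" by auto
    qed measurable
    also have "\<dots> \<le> prob ((T ^^ n) -` ?C \<inter> space M) + prob ?C"
      by (rule measure_Un_le) measurable
    also have "\<dots> = 2 * c n"
      by (subst measure_funpow_vimage) (simp_all add: c_def)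
    finally show ?case .
  qed
  have "(\<lambda>n. 2 * c n) \<longlonglongrightarrow> 0" using tendsto_mult_left[OF c, of 2] by simp
  then show ?thesis
    by (rule tendsto_sandwich[OF _ le tendsto_const, rotated]) auto
qed

end

subsection \<open>Returns and excursions\<close>

lemma return_time:
  assumes "\<exists>i>0. (T ^^ i) y \<in> Y"
  shows "0 < return_time T Y y" and "(T ^^ return_time T Y y) y \<in> Y"
    and "\<And>i. 0 < i \<Longrightarrow> i < return_time T Y y \<Longrightarrow> (T ^^ i) y \<notin> Y"
proof -
  let ?R = "{n. 0 < n \<and> (T ^^ n) y \<in> Y}"
  have "?R \<noteq> {}" using assms by auto
  from Inf_nat_def1[OF this]
  show "0 < return_time T Y y" "(T ^^ return_time T Y y) y \<in> Y"
    by (simp_all add: return_time_def)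
  fix i assume "0 < i" "i < return_time T Y y"
  then show "(T ^^ i) y \<notin> Y"
    using cInf_lower[of i ?R] by (auto simp: return_time_def)
qed

lemma return_time_eqI:
  assumes "0 < j" "(T ^^ j) y \<in> Y" "\<And>i. 0 < i \<Longrightarrow> i < j \<Longrightarrow> (T ^^ i) y \<notin> Y"
  shows "return_time T Y y = j"
  unfolding return_time_def
  by (rule cInf_eq_minimum) (use assms not_less in blast)+

text \<open>Times 1 to \<open>n\<close> are inspected and time 0 is not, so from a point of
  \<open>Y\<close> this is the number of steps of the induced map completed by time
  \<open>n\<close>.\<close>

primrec returns :: "('a \<Rightarrow> 'a) \<Rightarrow> 'a set \<Rightarrow> nat \<Rightarrow> 'a \<Rightarrow> nat" where
  "returns T Y 0 y = 0"
| "returns T Y (Suc n) y = returns T Y n y + of_bool ((T ^^ Suc n) y \<in> Y)"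

lemma returns_eq_birkhoff_sum:
  "real (returns T Y n y) = birkhoff_sum T n (indicator Y) y + indicator Y ((T ^^ n) y) - indicator Y y"
  by (induction n) (auto simp: birkhoff_sum_Suc simp del: funpow.simps)

lemma abs_returns_diff_le:
  "\<bar>real (returns T Y n y) - birkhoff_sum T n (indicator Y) y\<bar> \<le> 1"
  by (auto simp: returns_eq_birkhoff_sum indicator_def)

text \<open>Here \<open>j\<close> is the age at time \<open>n\<close> of the excursion in progress.
  In the induction either the excursion continues and \<open>j\<close> grows by one, or the orbit is
  back in \<open>Y\<close>, the induced map makes one more step and \<open>j\<close> restarts at
  0.\<close>

lemma last_return:
  assumes y: "y \<in> Y"
  shows "\<exists>j\<le>n. (T ^^ (n - j)) y \<in> Y \<and> (\<forall>i. 0 < i \<and> i \<le> j \<longrightarrow> (T ^^ i) ((T ^^ (n - j)) y) \<notin> Y) \<and>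
    (induced_map T Y ^^ returns T Y n y) y = (T ^^ (n - j)) y \<and>
    birkhoff_sum (induced_map T Y) (returns T Y n y) (induced_fun T Y f) y = birkhoff_sum T (n - j) f y"
proof (induction n)
  case 0
  then show ?case using y by auto
next
  case (Suc n)
  then obtain j where j: "j \<le> n" "(T ^^ (n - j)) y \<in> Y"
    "\<And>i. 0 < i \<Longrightarrow> i \<le> j \<Longrightarrow> (T ^^ i) ((T ^^ (n - j)) y) \<notin> Y"
    "(induced_map T Y ^^ returns T Y n y) y = (T ^^ (n - j)) y"
    "birkhoff_sum (induced_map T Y) (returns T Y n y) (induced_fun T Y f) y = birkhoff_sum T (n - j) f y"
    by blast
  define z where "z = (T ^^ (n - j)) y"
  have next_z: "(T ^^ Suc j) z = (T ^^ Suc n) y"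
    unfolding z_def funpow_funpow using j(1) by simp
  show ?case
  proof (cases "(T ^^ Suc n) y \<in> Y")
    case False
    have "(T ^^ i) z \<notin> Y" if "0 < i" "i \<le> Suc j" for i
      using j(3)[of i] that False next_z by (cases "i = Suc j") (auto simp: z_def)
    then show ?thesis
      using j False by (intro exI[of _ "Suc j"]) (auto simp: z_def simp del: funpow.simps)
  next
    case True
    \<comment> \<open>The orbit of \<open>z\<close> avoids \<open>Y\<close> at times 1 to
      \<open>j\<close>, so its visit at time \<open>Suc j\<close> is a first return.\<close>
    have ret: "return_time T Y z = Suc j"
      by (rule return_time_eqI) (use True next_z j(3) in \<open>auto simp: z_def simp del: funpow.simps\<close>)
    have map: "induced_map T Y z = (T ^^ Suc n) y"
      by (simp only: induced_map_def ret next_z)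
    have "birkhoff_sum (induced_map T Y) (Suc (returns T Y n y)) (induced_fun T Y f) y
      = birkhoff_sum T (n - j) f y + birkhoff_sum T (Suc j) f z"
      using j(2,4,5) ret by (simp add: birkhoff_sum_Suc z_def induced_fun_def birkhoff_sum_def del: funpow.simps)
    also have "\<dots> = birkhoff_sum T (Suc n) f y"
      using birkhoff_sum_add[of T "n - j" "Suc j" f y] j(1) by (simp add: z_def)
    finally have "birkhoff_sum (induced_map T Y) (Suc (returns T Y n y)) (induced_fun T Y f) y
      = birkhoff_sum T (Suc n) f y" .
    moreover have "(induced_map T Y ^^ Suc (returns T Y n y)) y = (T ^^ Suc n) y"
      using j(4) map by (simp add: z_def)
    ultimately show ?thesis
      using True by (intro exI[of _ 0]) (auto simp del: funpow.simps)
  qed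
qed

locale induced_system = ergodic_pmp +
  fixes Y :: "'a set"
  assumes Y [measurable]: "Y \<in> sets M" and Y_pos: "0 < measure M Y"
begin

abbreviation "T\<^sub>Y \<equiv> induced_map T Y"

lemma return_time_measurable [measurable]: "return_time T Y \<in> measurable M (count_space UNIV)"
proof -
  have *: "return_time T Y = (\<lambda>y. LEAST n. 0 < n \<and> (T ^^ n) y \<in> Y)"
    by (auto simp: return_time_def Inf_nat_def)
  show ?thesis
    unfolding * by measurable
qed

lemma induced_map_measurable [measurable]: "T\<^sub>Y \<in> measurable M M"
  unfolding induced_map_def[abs_def] by (rule measurable_compose_countable) auto

lemma funpow_induced_map_measurable [measurable]: "(T\<^sub>Y ^^ n) \<in> measurable M M"
  by (induction n) (auto simp: measurable_comp)

lemma induced_fun_measurable [measurable]: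
  assumes [measurable]: "f \<in> borel_measurable M"
  shows "induced_fun T Y f \<in> borel_measurable M"
proof -
  have [measurable]: "(\<lambda>y. \<Sum>k<return_time T Y y. f ((T ^^ k) y)) \<in> borel_measurable M"
    by (rule measurable_compose_countable[where f = "\<lambda>n y. \<Sum>k<n. f ((T ^^ k) y)"]) auto
  show ?thesis
    unfolding induced_fun_def[abs_def] by measurable
qed

lemma birkhoff_sum_induced_measurable [measurable]:
  assumes [measurable]: "g \<in> borel_measurable M"
  shows "birkhoff_sum T\<^sub>Y n g \<in> borel_measurable M"
  unfolding birkhoff_sum_def[abs_def] by measurable

text \<open>The tail event that the return time exceeds \<open>j\<close>, expressed through the
  iterates so that it also contains the points that never return.\<close>

definition excursion :: "nat \<Rightarrow> 'a set" where
  "excursion j = {y\<in>space M. y \<in> Y \<and> (\<forall>i\<in>{1..j}. (T ^^ i) y \<notin> Y)}"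

lemma excursion_sets [measurable]: "excursion j \<in> events"
  unfolding excursion_def by measurable

end

context pmp
begin

text \<open>Typically \<open>E j\<close> says that an excursion of length about \<open>j\<close> starts at the point. At most one
  such excursion is in progress at time \<open>n\<close>, so the pullbacks to time \<open>0\<close> are disjoint.\<close>

lemma sum_prob_pullback_le:
  assumes E: "\<And>j. j \<in> J \<Longrightarrow> E j \<in> events" and J: "J \<subseteq> {..n}"
    and sep: "\<And>j j' x. j \<in> J \<Longrightarrow> j' \<in> J \<Longrightarrow> j < j' \<Longrightarrow> x \<in> E j' \<Longrightarrow> (T ^^ (j' - j)) x \<notin> E j"
    and C: "C \<in> events" "\<And>j x. j \<in> J \<Longrightarrow> x \<in> space M \<Longrightarrow> (T ^^ (n - j)) x \<in> E j \<Longrightarrow> x \<in> C"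
  shows "(\<Sum>j\<in>J. prob (E j)) \<le> prob C"
proof -
  let ?D = "\<lambda>j. (T ^^ (n - j)) -` E j \<inter> space M"
  have fin: "finite J" using J finite_subset by blast
  have D: "?D j \<in> events" if "j \<in> J" for j
    using E[OF that] by (intro measurable_sets[OF funpow_measurable])
  have not_less: "\<not> j < j'" if "j \<in> J" "j' \<in> J" "x \<in> ?D j" "x \<in> ?D j'" for j j' x
  proof
    assume less: "j < j'"
    then have "(j' - j) + (n - j') = n - j" using that J by auto
    then have "(T ^^ (j' - j)) ((T ^^ (n - j')) x) = (T ^^ (n - j)) x"
      by (simp only: funpow_funpow)
    then show False using sep[OF that(1,2) less, of "(T ^^ (n - j')) x"] that(3,4) by simp
  qed
  have "disjoint_family_on ?D J"
    unfolding disjoint_family_on_def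
  proof (intro ballI impI equals0I)
    fix j j' x assume "j \<in> J" "j' \<in> J" "j \<noteq> j'" "x \<in> ?D j \<inter> ?D j'"
    then show False using not_less[of j j' x] not_less[of j' j x] by (cases "j < j'") auto
  qed
  then have "(\<Sum>j\<in>J. prob (?D j)) = prob (\<Union>j\<in>J. ?D j)"
    using D by (intro finite_measure_finite_Union[symmetric] fin) blast+
  also have "\<dots> \<le> prob C"
    using C by (intro finite_measure_mono) auto
  finally show ?thesis
    using E by (simp add: measure_funpow_vimage)
qed

end

section \<open>Recurrence, the induced map and unfinished excursions\<close>

context induced_system
begin

text \<open>One half of Kac's formula, the tails of the return time being summed instead of
  integrating it. Two different starting times cannot both begin the excursion in progress at time
  \<open>n\<close>.\<close>

lemma sum_prob_excursion_le: "(\<Sum>j\<le>n. prob (excursion j)) \<le> 1"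
proof -
  have "(\<Sum>j\<le>n. prob (excursion j)) \<le> prob (space M)"
    by (rule sum_prob_pullback_le[of _ _ n]) (auto simp: excursion_def)
  then show ?thesis by (simp add: prob_space)
qed

lemma summable_prob_excursion: "summable (\<lambda>j. prob (excursion j))"
proof (rule summableI_nonneg_bounded)
  fix n
  have "(\<Sum>j<n. prob (excursion j)) \<le> (\<Sum>j\<le>n. prob (excursion j))"
    by (rule sum_mono2) auto
  then show "(\<Sum>j<n. prob (excursion j)) \<le> 1" using sum_prob_excursion_le[of n] by simp
qed simp

text \<open>On this set \<^const>\<open>return_time\<close> is the infimum of the empty set of natural numbers, which is an
  unspecified number; in particular the induced map may leave \<open>Y\<close>.\<close>

definition never_returns :: "'a set" where
  "never_returns = {y\<in>space M. y \<in> Y \<and> (\<forall>i>0. (T ^^ i) y \<notin> Y)}"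

lemma never_returns_sets [measurable]: "never_returns \<in> events"
  unfolding never_returns_def by measurable

text \<open>Poincare recurrence: such points lie in every \<open>excursion j\<close>, and these
  probabilities are summable, hence tend to 0.\<close>

lemma prob_never_returns: "prob never_returns = 0"
proof -
  have "prob never_returns \<le> prob (excursion j)" for j
    by (intro finite_measure_mono) (auto simp: excursion_def never_returns_def)
  then have "prob never_returns \<le> 0"
    using summable_LIMSEQ_zero[OF summable_prob_excursion] by (intro LIMSEQ_le_const) auto
  then show ?thesis by (simp add: measure_le_0_iff)
qed

lemma prob_Un_never_returns: "A \<in> events \<Longrightarrow> prob (A \<union> never_returns) \<le> prob A"
  using measure_Un_le[of A M never_returns] by (simp add: prob_never_returns)

lemma induced_map_in: "y \<in> Y \<Longrightarrow> y \<notin> never_returns \<Longrightarrow> T\<^sub>Y y \<in> Y"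
  using sets.sets_into_space[OF Y] return_time(2)[of T y Y]
  by (auto simp: never_returns_def induced_map_def)

lemma in_Y_sets [measurable (raw)]:
  assumes "Measurable.pred M Q"
  shows "{y\<in>Y. Q y} \<in> events"
proof -
  have "{y\<in>Y. Q y} = {y\<in>space M. y \<in> Y \<and> Q y}"
    using sets.sets_into_space[OF Y] by auto
  then show ?thesis using assms by simp
qed

text \<open>Split according to the return time \<open>j\<close>. A point that is in
  \<open>R j\<close> at time \<open>n - j\<close> is in \<open>A\<close> at time \<open>n\<close>,
  and for different \<open>j\<close> these events are disjoint. The resulting inequality is the half
  of invariance that bounds bad events.\<close>

lemma prob_induced_map_vimage_le:
  assumes A [measurable]: "A \<in> events" and AY: "A \<subseteq> Y"
  shows "prob {y\<in>Y. T\<^sub>Y y \<in> A} \<le> prob A"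
proof -
  define R where
    "R j = {y\<in>space M. y \<in> Y \<and> y \<notin> never_returns \<and> return_time T Y y = j \<and> T\<^sub>Y y \<in> A}" for j
  have R [measurable]: "R j \<in> events" for j
    unfolding R_def by measurable
  have returns: "\<exists>i>0. (T ^^ i) y \<in> Y" if "y \<in> R j" for y j
    using that by (auto simp: R_def never_returns_def)
  have R0: "R 0 = {}"
    using return_time(1)[OF returns] by (force simp: R_def)
  have le: "(\<Sum>j\<le>n. prob (R j)) \<le> prob A" for n
  proof -
    have "(\<Sum>j\<le>n. prob (R j)) \<le> prob ((T ^^ n) -` A \<inter> space M)"
    proof (rule sum_prob_pullback_le[of _ _ n])
      fix j x assume jx: "j \<in> {..n}" "x \<in> space M" "(T ^^ (n - j)) x \<in> R j"
      then have "(T ^^ j) ((T ^^ (n - j)) x) \<in> A"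
        by (auto simp: R_def induced_map_def)
      moreover have "(T ^^ j) ((T ^^ (n - j)) x) = (T ^^ n) x"
        using jx(1) by (simp add: funpow_funpow)
      ultimately show "x \<in> (T ^^ n) -` A \<inter> space M" using jx by auto
    next
      \<comment> \<open>For \<open>j > 0\<close> the time \<open>j' - j\<close> lies strictly
        between 0 and the first return at \<open>j'\<close>, so the orbit is outside
        \<open>Y\<close>.\<close>
      fix j j' x assume *: "j < j'" "x \<in> R j'"
      show "(T ^^ (j' - j)) x \<notin> R j"
      proof (cases "j = 0")
        case False
        then show ?thesis
          using return_time(3)[OF returns[OF *(2)], of "j' - j"] * by (auto simp: R_def)
      qed (simp add: R0)
    qed auto
    then show ?thesis
      by (simp add: measure_funpow_vimage)
  qed
  have "(\<lambda>j. prob (R j)) sums prob (\<Union>j. R j)"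
    by (rule finite_measure_UNION) (auto simp: disjoint_family_on_def R_def)
  then have UN_le: "prob (\<Union>j. R j) \<le> prob A"
    using le by (intro LIMSEQ_le_const2[of "\<lambda>n. \<Sum>j\<le>n. prob (R j)"]) (auto simp: sums_def_le)
  have "prob {y\<in>Y. T\<^sub>Y y \<in> A} \<le> prob ((\<Union>j. R j) \<union> never_returns)"
    using sets.sets_into_space[OF Y] by (intro finite_measure_mono) (auto simp: R_def)
  also have "\<dots> \<le> prob (\<Union>j. R j)"
    by (rule prob_Un_never_returns) auto
  finally show ?thesis using UN_le by simp
qed

lemma prob_funpow_induced_map_vimage_le:
  assumes A [measurable]: "A \<in> events" and AY: "A \<subseteq> Y"
  shows "prob {y\<in>Y. (T\<^sub>Y ^^ k) y \<in> A} \<le> prob A"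
proof (induction k)
  case 0
  show ?case using AY by (intro finite_measure_mono) auto
next
  case (Suc k)
  let ?A = "\<lambda>k. {y\<in>Y. (T\<^sub>Y ^^ k) y \<in> A}"
  have A_sets [measurable]: "?A k \<in> events" for k by measurable
  \<comment> \<open>Membership in \<open>?A k\<close> includes being in \<open>Y\<close>, which the
    image of a point of \<open>Y\<close> may violate on \<open>never_returns\<close>.\<close>
  have "prob (?A (Suc k)) \<le> prob ({y\<in>Y. T\<^sub>Y y \<in> ?A k} \<union> never_returns)"
  proof (rule finite_measure_mono)
    show "?A (Suc k) \<subseteq> {y\<in>Y. T\<^sub>Y y \<in> ?A k} \<union> never_returns"
      by (auto simp: induced_map_in funpow_swap1)
    show "{y\<in>Y. T\<^sub>Y y \<in> ?A k} \<union> never_returns \<in> events"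
      by (intro sets.Un in_Y_sets never_returns_sets) measurable
  qed
  also have "\<dots> \<le> prob {y\<in>Y. T\<^sub>Y y \<in> ?A k}"
    by (intro prob_Un_never_returns in_Y_sets) measurable
  also have "\<dots> \<le> prob (?A k)"
    by (rule prob_induced_map_vimage_le) auto
  finally show ?case using Suc by simp
qed

text \<open>An induced orbit can leave \<open>Y\<close> only through \<open>never_returns\<close>,
  whose preimages under the iterates are null as well.\<close>

lemma prob_funpow_induced_map_leaves: "prob {y\<in>Y. (T\<^sub>Y ^^ k) y \<notin> Y} = 0"
proof (induction k)
  case (Suc k)
  have "prob {y\<in>Y. (T\<^sub>Y ^^ Suc k) y \<notin> Y}
    \<le> prob ({y\<in>Y. (T\<^sub>Y ^^ k) y \<notin> Y} \<union> {y\<in>Y. (T\<^sub>Y ^^ k) y \<in> never_returns})"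
    by (intro finite_measure_mono) (auto simp: induced_map_in)
  also have "\<dots> \<le> prob {y\<in>Y. (T\<^sub>Y ^^ k) y \<notin> Y} + prob {y\<in>Y. (T\<^sub>Y ^^ k) y \<in> never_returns}"
    by (rule measure_Un_le) auto
  also have "\<dots> \<le> 0 + prob never_returns"
    using prob_funpow_induced_map_vimage_le[of never_returns k] Suc
    by (auto simp: never_returns_def)
  finally show ?case by (simp add: prob_never_returns measure_le_0_iff)
qed simp

text \<open>The excursion in progress at time \<open>n\<close> has already accumulated a sum beyond
  \<open>r\<close>. The starting point ranges over the whole space, so that invariance can shift the
  time \<open>n - j\<close> to 0.\<close>

definition late_sum_exceeds :: "('a \<Rightarrow> real) \<Rightarrow> real \<Rightarrow> nat \<Rightarrow> 'a set" where
  "late_sum_exceeds f r n = {x\<in>space M. \<exists>j\<in>{..n}. (T ^^ (n - j)) x \<in> excursion j \<and>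
     r < \<bar>birkhoff_sum T j f ((T ^^ (n - j)) x)\<bar>}"

lemma late_sum_exceeds_sets [measurable]:
  assumes [measurable]: "f \<in> borel_measurable M"
  shows "late_sum_exceeds f r n \<in> events"
  unfolding late_sum_exceeds_def by measurable

text \<open>A union bound over the age \<open>j\<close>, together with invariance, gives the bound
  \<open>\<Sum>j. a j K\<close>, uniform in \<open>n\<close>. Each term tends to 0 as
  \<open>K\<close> grows and is dominated by the summable \<open>prob (excursion j)\<close>, so
  Tannery's theorem applies.\<close>

lemma prob_late_sum_exceeds_tendsto_0:
  assumes f [measurable]: "f \<in> borel_measurable M"
    and b: "filterlim b at_top sequentially"
  shows "(\<lambda>n. prob (late_sum_exceeds f (b n) n)) \<longlonglongrightarrow> 0"
proof (rule tendsto_0_along_at_top[OF _ b])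
  define a where "a j K = prob {y\<in>space M. y \<in> excursion j \<and> real K < \<bar>birkhoff_sum T j f y\<bar>}" for j K
  have a_le: "a j K \<le> prob (excursion j)" for j K
    unfolding a_def by (intro finite_measure_mono) auto
  have a_nonneg: "0 \<le> a j K" for j K by (simp add: a_def)
  have a_summable: "summable (\<lambda>j. a j K)" for K
    by (rule summable_comparison_test'[OF summable_prob_excursion, of 0]) (simp add: a_nonneg a_le)
  have "((\<lambda>K. \<Sum>j. a j K) \<longlonglongrightarrow> (\<Sum>j. 0))"
  proof (rule tannerys_theorem[THEN conjunct2, THEN conjunct2])
    show "(\<lambda>K. a j K) \<longlonglongrightarrow> 0" for j
    proof (rule tendsto_sandwich[OF _ _ tendsto_const])
      show "(\<lambda>K. prob {y\<in>space M. real K < \<bar>birkhoff_sum T j f y\<bar>}) \<longlonglongrightarrow> 0"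
        by (rule prob_tail_tendsto_0) measurable
      show "\<forall>\<^sub>F K in sequentially. a j K \<le> prob {y\<in>space M. real K < \<bar>birkhoff_sum T j f y\<bar>}"
        unfolding a_def by (intro always_eventually allI finite_measure_mono) auto
    qed (simp add: a_nonneg)
    show "\<forall>\<^sub>F (j, K) in at_top \<times>\<^sub>F sequentially. norm (a j K) \<le> prob (excursion j)"
      by (intro always_eventually) (auto simp: a_nonneg a_le)
    show "summable (\<lambda>j. prob (excursion j))" by (rule summable_prob_excursion)
  qed simp
  then show "(\<lambda>K. \<Sum>j. a j K) \<longlonglongrightarrow> 0" by simp
  fix K n assume K: "real K \<le> b n"
  let ?D = "\<lambda>j. {y\<in>space M. y \<in> excursion j \<and> real K < \<bar>birkhoff_sum T j f y\<bar>}"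
  have "prob (late_sum_exceeds f (b n) n) \<le> prob (\<Union>j\<in>{..n}. (T ^^ (n - j)) -` ?D j \<inter> space M)"
  proof (rule finite_measure_mono)
    show "late_sum_exceeds f (b n) n \<subseteq> (\<Union>j\<in>{..n}. (T ^^ (n - j)) -` ?D j \<inter> space M)"
      using K sets.sets_into_space[OF excursion_sets] by (fastforce simp: late_sum_exceeds_def)
  qed auto
  also have "\<dots> \<le> (\<Sum>j\<le>n. prob ((T ^^ (n - j)) -` ?D j \<inter> space M))"
    by (rule finite_measure_subadditive_finite) auto
  also have "\<dots> = (\<Sum>j\<le>n. a j K)"
    by (intro sum.cong refl, subst measure_funpow_vimage) (simp_all add: a_def)
  also have "\<dots> \<le> (\<Sum>j. a j K)"
    by (rule sum_le_suminf[OF a_summable]) (auto simp: a_nonneg)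
  finally show "prob (late_sum_exceeds f (b n) n) \<le> (\<Sum>j. a j K)" .
qed simp

end

subsection \<open>Comparison with the induced sums\<close>

text \<open>The assumption \<open>tight_maxima\<close> is tightness in the form used below: one
  constant \<open>C\<close> for all lengths \<open>m\<close>, the maximum unfolded into an
  existential, and probabilities of subsets of \<open>Y\<close> taken without normalization.\<close>

locale induced_renormalization = induced_system M T Y + renormalization B L d
  for M :: "'a measure" and T Y B L d +
  fixes f :: "'a \<Rightarrow> real"
  assumes f_measurable [measurable]: "f \<in> borel_measurable M"
    and tight_maxima: "\<And>\<eta>. 0 < \<eta> \<Longrightarrow> \<exists>C>0. \<forall>m\<ge>1. prob {y\<in>Y. \<exists>k\<in>{1..m}.
      C * B (real m / prob Y) < \<bar>birkhoff_sum (induced_map T Y) k (induced_fun T Y f) y\<bar>} \<le> \<eta>"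
begin

abbreviation "S\<^sub>Y k \<equiv> birkhoff_sum T\<^sub>Y k (induced_fun T Y f)"

text \<open>A deterministic substitute for the random number of returns by time \<open>n\<close>, so
  that the limit law of the induced sums can be used along it.\<close>

definition mean_returns :: "nat \<Rightarrow> nat" where
  "mean_returns n = nat \<lfloor>real n * prob Y\<rfloor>"

lemma mean_returns_close: "\<bar>real (mean_returns n) - real n * prob Y\<bar> \<le> 1"
proof -
  have "real (mean_returns n) = of_int \<lfloor>real n * prob Y\<rfloor>"
    by (simp add: mean_returns_def)
  then show ?thesis by linarith
qed

lemma mean_returns_at_top: "filterlim mean_returns at_top sequentially"
proof -
  have "filterlim (\<lambda>n. real n * prob Y) at_top sequentially"
    using Y_pos filterlim_real_sequentially
    by (intro filterlim_at_top_mult_tendsto_pos[OF tendsto_const])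
  then show ?thesis
    unfolding mean_returns_def
    by (intro filterlim_compose[OF filterlim_nat_sequentially] filterlim_compose[OF filterlim_floor_sequentially])
qed

lemma B_seq_at_top: "filterlim (\<lambda>n. B (real n)) at_top sequentially"
  by (rule filterlim_compose[OF B_at_top filterlim_real_sequentially])

text \<open>Each of the hypotheses \<open>late\<close>, \<open>freq\<close>, \<open>in_Y\<close> and \<open>window\<close> holds off an event of small probability.\<close>

lemma birkhoff_sum_near_induced:
  fixes n l :: nat and s K \<delta> :: real
  defines "r \<equiv> mean_returns n - l"
  assumes y: "y \<in> Y"
    and late: "y \<notin> late_sum_exceeds f s n"
    and freq: "\<bar>birkhoff_sum T n (indicator Y) y / real n - prob Y\<bar> < \<delta> / 2"
    and n: "4 \<le> \<delta> * real n" "\<delta> * real n \<le> real l"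
    and in_Y: "(T\<^sub>Y ^^ r) y \<in> Y"
    and window: "\<And>k. k \<in> {1..2 * l} \<Longrightarrow> \<bar>S\<^sub>Y k ((T\<^sub>Y ^^ r) y)\<bar> \<le> K" and K: "0 \<le> K"
  shows "\<bar>birkhoff_sum T n f y - S\<^sub>Y (mean_returns n) y\<bar> \<le> s + 2 * K"
proof -
  define N where "N = returns T Y n y"
  have n0: "0 < n" using n(1) by (cases "n = 0") auto
  obtain j where j: "j \<le> n" "(T ^^ (n - j)) y \<in> Y"
    "\<And>i. 0 < i \<Longrightarrow> i \<le> j \<Longrightarrow> (T ^^ i) ((T ^^ (n - j)) y) \<notin> Y" "S\<^sub>Y N y = birkhoff_sum T (n - j) f y"
    unfolding N_def using last_return[OF y, of n T f] by blast
  have ysp: "y \<in> space M" using y sets.sets_into_space[OF Y] by auto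
  have "(T ^^ (n - j)) y \<in> excursion j"
    using j sets.sets_into_space[OF Y] by (auto simp: excursion_def)
  then have "\<bar>birkhoff_sum T j f ((T ^^ (n - j)) y)\<bar> \<le> s"
    using late j(1) ysp by (auto simp: late_sum_exceeds_def not_less)
  moreover have "birkhoff_sum T n f y = S\<^sub>Y N y + birkhoff_sum T j f ((T ^^ (n - j)) y)"
    using birkhoff_sum_add[of T "n - j" j f y] j by simp
  ultimately have 1: "\<bar>birkhoff_sum T n f y - S\<^sub>Y N y\<bar> \<le> s" by simp
  have "\<bar>birkhoff_sum T n (indicator Y) y - real n * prob Y\<bar>
    = real n * \<bar>birkhoff_sum T n (indicator Y) y / real n - prob Y\<bar>"
    using n0 by (simp add: abs_mult_pos' right_diff_distrib)
  also have "\<dots> \<le> real n * (\<delta> / 2)" using freq by (intro mult_left_mono) auto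
  finally have "\<bar>birkhoff_sum T n (indicator Y) y - real n * prob Y\<bar> \<le> \<delta> * real n / 2"
    by (simp add: mult.commute)
  \<comment> \<open>The frequency contributes \<open>\<delta> * n / 2\<close> and the two roundings
    contribute 1 each; the latter are absorbed since \<open>4 \<le> \<delta> * n\<close>.\<close>
  then have "\<bar>real N - real (mean_returns n)\<bar> \<le> real l"
    using abs_returns_diff_le[of T Y n y] mean_returns_close[of n] n unfolding N_def by linarith
  then have "N \<le> mean_returns n + l" "mean_returns n \<le> N + l" by linarith+
  \<comment> \<open>Both indices lie between \<open>r\<close> and \<open>r + 2 * l\<close>, also
    when the subtraction in \<open>r\<close> is truncated to 0. The two sums are then compared
    through the one at \<open>r\<close>.\<close>
  then have idx: "N = r + (N - r)" "mean_returns n = r + (mean_returns n - r)"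
    "N - r \<le> 2 * l" "mean_returns n - r \<le> 2 * l"
    by (auto simp: r_def)
  have "\<bar>S\<^sub>Y (r + k) y - S\<^sub>Y r y\<bar> \<le> K" if "k \<le> 2 * l" for k
    using window[of k] K that by (cases "k = 0") (auto simp: birkhoff_sum_add)
  from this[OF idx(3)] this[OF idx(4)] have "\<bar>S\<^sub>Y N y - S\<^sub>Y (mean_returns n) y\<bar> \<le> 2 * K"
    unfolding idx(1,2)[symmetric] by linarith
  with 1 show ?thesis by linarith
qed

text \<open>Outside the bad events \<open>E1\<close> to \<open>E4\<close> the previous lemma bounds
  the difference. Of the allowed error \<open>e * B n\<close>, the unfinished excursion takes one
  half and the two window sums take a quarter each.\<close>

lemma birkhoff_sum_induced_diff_tendsto_0:
  assumes e: "0 < e"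
  shows "(\<lambda>n. prob {y\<in>Y. e < \<bar>birkhoff_sum T n f y / B (real n) - S\<^sub>Y (mean_returns n) y / B (real n)\<bar>})
    \<longlonglongrightarrow> 0"
proof (rule order_tendstoI)
  fix r :: real assume r: "0 < r"
  obtain C where C: "0 < C" "\<And>m. 1 \<le> m \<Longrightarrow>
      prob {y\<in>Y. \<exists>k\<in>{1..m}. C * B (real m / prob Y) < \<bar>S\<^sub>Y k y\<bar>} \<le> r / 4"
    using tight_maxima[of "r / 4"] r by auto
  \<comment> \<open>With this \<open>c\<close>, \<open>C * B (c * n)\<close> is asymptotic to
    \<open>e / 8 * B n\<close>, hence eventually below the required
    \<open>e / 4 * B n\<close>.\<close>
  define c where "c = (e / (8 * C)) powr (1 / d)"
  have c: "0 < c" "c powr d = e / (8 * C)"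
    using e C d_pos by (auto simp: c_def powr_powr)
  \<comment> \<open>Rounding gives \<open>2 * l n \<le> 3 * \<delta> * n\<close> once
    \<open>\<delta> * n \<ge> 4\<close>, so the window has length at most
    \<open>c * n * prob Y\<close>.\<close>
  define \<delta> where "\<delta> = c * prob Y / 3"
  have \<delta>: "0 < \<delta>" using c Y_pos by (simp add: \<delta>_def)
  define l where "l n = nat \<lceil>\<delta> * real n\<rceil>" for n
  have l: "\<delta> * real n \<le> real (l n)" "real (l n) \<le> \<delta> * real n + 1" for n
  proof -
    have "0 \<le> \<delta> * real n" using \<delta> by simp
    then have "real (l n) = of_int \<lceil>\<delta> * real n\<rceil>" unfolding l_def by simp
    then show "\<delta> * real n \<le> real (l n)" "real (l n) \<le> \<delta> * real n + 1" by linarith+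
  qed
  obtain x0 where x0: "0 < x0" "mono_on {x0..} B" using B_eventually_mono by blast
  define E1 where "E1 n = late_sum_exceeds f (e / 2 * B (real n)) n" for n
  define E2 where "E2 n = {x\<in>space M. \<delta> / 2 \<le> \<bar>birkhoff_sum T n (indicator Y) x / real n - prob Y\<bar>}" for n
  define G where "G n = {y\<in>Y. \<exists>k\<in>{1..2 * l n}. C * B (real (2 * l n) / prob Y) < \<bar>S\<^sub>Y k y\<bar>}" for n
  define q where "q n = mean_returns n - l n" for n
  \<comment> \<open>The window starts at the random point reached after \<open>q n\<close> induced
    steps; the subinvariance of the induced map reduces this event to \<open>G n\<close>, which
    starts at time 0 and is controlled by tightness.\<close>
  define E3 where "E3 n = {y\<in>Y. (T\<^sub>Y ^^ q n) y \<in> G n}" for n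
  define E4 where "E4 n = {y\<in>Y. (T\<^sub>Y ^^ q n) y \<notin> Y}" for n
  have [measurable]: "E1 n \<in> events" "E2 n \<in> events" "G n \<in> events" for n
    by (simp_all add: E1_def E2_def G_def)
  have [measurable]: "E3 n \<in> events" "E4 n \<in> events" for n
    by (simp_all add: E3_def E4_def)
  have "(\<lambda>n. prob (E1 n)) \<longlonglongrightarrow> 0"
    unfolding E1_def using e B_seq_at_top
    by (intro prob_late_sum_exceeds_tendsto_0 filterlim_tendsto_pos_mult_at_top[OF tendsto_const]) auto
  then have ev1: "\<forall>\<^sub>F n in sequentially. prob (E1 n) < r / 4"
    using r by (intro order_tendstoD) auto
  have E2_le: "prob (E2 n) \<le> (\<integral>x. \<bar>birkhoff_sum T n (indicator Y) x / real n - prob Y\<bar> \<partial>M) / (\<delta> / 2)" for n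
  proof -
    have "integrable M (indicator Y :: 'a \<Rightarrow> real)"
      by (intro integrable_real_indicator) (auto simp: less_top[symmetric])
    then have "integrable M (birkhoff_sum T n (indicator Y))"
      unfolding birkhoff_sum_def[abs_def] by (intro Bochner_Integration.integrable_sum integrable_funpow)
    then show ?thesis
      unfolding E2_def using \<delta> by (intro integral_Markov_inequality_measure[where A = "{}"]) auto
  qed
  have "(\<lambda>n. (\<integral>x. \<bar>birkhoff_sum T n (indicator Y) x / real n - prob Y\<bar> \<partial>M) / (\<delta> / 2)) \<longlonglongrightarrow> 0 / (\<delta> / 2)"
    using \<delta> by (intro tendsto_divide mean_ergodic_indicator tendsto_const) auto
  then have "(\<lambda>n. prob (E2 n)) \<longlonglongrightarrow> 0"
    unfolding div_0
    by (rule tendsto_sandwich[OF _ always_eventually[OF allI, OF E2_le] tendsto_const, rotated]) simp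
  then have ev2: "\<forall>\<^sub>F n in sequentially. prob (E2 n) < r / 4"
    using r by (intro order_tendstoD) auto
  have "(\<lambda>n. B (c * real n) / B (real n)) \<longlonglongrightarrow> e / (8 * C)"
    using filterlim_compose[OF B_ratio[OF c(1)] filterlim_real_sequentially] c(2) by simp
  then have ev3: "\<forall>\<^sub>F n in sequentially. B (c * real n) / B (real n) < e / (4 * C)"
    by (rule order_tendstoD) (use e C in \<open>auto simp: field_simps\<close>)
  have "filterlim (\<lambda>n. \<delta> * real n) at_top sequentially"
    using \<delta> filterlim_real_sequentially by (intro filterlim_tendsto_pos_mult_at_top[OF tendsto_const])
  then have ev4: "\<forall>\<^sub>F n in sequentially. max 4 (x0 * prob Y) \<le> \<delta> * real n"
    unfolding filterlim_at_top by blast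
  show "\<forall>\<^sub>F n in sequentially.
      prob {y\<in>Y. e < \<bar>birkhoff_sum T n f y / B (real n) - S\<^sub>Y (mean_returns n) y / B (real n)\<bar>} < r"
    using ev1 ev2 ev3 ev4
  proof eventually_elim
    case (elim n)
    then have n: "4 \<le> \<delta> * real n" "x0 * prob Y \<le> \<delta> * real n" by auto
    then have n0: "0 < real n" by (cases "n = 0") auto
    have Bn: "0 < B (real n)" using B_pos[OF n0] .
    let ?m = "real (2 * l n) / prob Y"
    have m: "x0 \<le> ?m" "?m \<le> c * real n"
    proof -
      show "x0 \<le> ?m" using l(1)[of n] n Y_pos by (simp add: pos_le_divide_eq)
      have "real (2 * l n) \<le> 3 * (\<delta> * real n)" using l(2)[of n] n by simp
      also have "\<dots> = c * real n * prob Y" by (simp add: \<delta>_def)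
      finally show "?m \<le> c * real n" using Y_pos by (simp add: pos_divide_le_eq)
    qed
    have "B ?m \<le> B (c * real n)"
      using x0 m by (auto simp: mono_on_def)
    also have "\<dots> \<le> e / (4 * C) * B (real n)"
      using elim(3) Bn by (simp add: pos_divide_less_eq)
    finally have CB: "C * B ?m \<le> e / 4 * B (real n)"
      using C(1) by (simp add: field_simps)
    have m0: "0 < ?m" using x0 m by linarith
    have l1: "1 \<le> 2 * l n" using m0 by (cases "l n") auto
    have "prob {y\<in>Y. e < \<bar>birkhoff_sum T n f y / B (real n) - S\<^sub>Y (mean_returns n) y / B (real n)\<bar>}
      \<le> prob (((E1 n \<union> E2 n) \<union> E3 n) \<union> E4 n)"
    proof (intro finite_measure_mono subsetI)
      fix y assume y: "y \<in> {y\<in>Y. e < \<bar>birkhoff_sum T n f y / B (real n) - S\<^sub>Y (mean_returns n) y / B (real n)\<bar>}"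
      show "y \<in> ((E1 n \<union> E2 n) \<union> E3 n) \<union> E4 n"
      proof (rule ccontr)
        assume "y \<notin> ((E1 n \<union> E2 n) \<union> E3 n) \<union> E4 n"
        then have not_E: "y \<notin> E1 n" "y \<notin> E2 n" "y \<notin> E3 n" "y \<notin> E4 n" by auto
        have "\<bar>birkhoff_sum T n f y - S\<^sub>Y (mean_returns n) y\<bar> \<le> e / 2 * B (real n) + 2 * (C * B ?m)"
        proof (rule birkhoff_sum_near_induced[where \<delta> = \<delta> and l = "l n"])
          show "y \<notin> late_sum_exceeds f (e / 2 * B (real n)) n" using not_E(1) by (simp add: E1_def)
          show "\<bar>birkhoff_sum T n (indicator Y) y / real n - prob Y\<bar> < \<delta> / 2"
            using not_E(2) y sets.sets_into_space[OF Y] by (auto simp: E2_def)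
          show in_Y: "(T\<^sub>Y ^^ (mean_returns n - l n)) y \<in> Y"
            using not_E(4) y by (auto simp: E4_def q_def)
          show "\<bar>S\<^sub>Y k ((T\<^sub>Y ^^ (mean_returns n - l n)) y)\<bar> \<le> C * B ?m" if "k \<in> {1..2 * l n}" for k
            using not_E(3) y that in_Y by (auto simp: E3_def G_def q_def not_less)
          show "0 \<le> C * B ?m" using C(1) B_pos[OF m0] by simp
        qed (use y n l in auto)
        also have "\<dots> \<le> e * B (real n)" using CB by simp
        finally have "\<bar>birkhoff_sum T n f y - S\<^sub>Y (mean_returns n) y\<bar> / B (real n) \<le> e"
          using Bn by (simp add: pos_divide_le_eq)
        then show False
          using y Bn by (simp flip: diff_divide_distrib)
      qed
    qed auto
    also have "\<dots> \<le> prob (E1 n) + prob (E2 n) + prob (E3 n) + prob (E4 n)"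
      by (intro order_trans[OF measure_Un_le] add_mono order_refl) auto
    also have "\<dots> < r / 4 + r / 4 + r / 4 + r / 4"
    proof -
      have "prob (E3 n) \<le> prob (G n)"
        unfolding E3_def by (rule prob_funpow_induced_map_vimage_le) (auto simp: G_def)
      also have "\<dots> \<le> r / 4" unfolding G_def using C(2)[OF l1] by simp
      finally have "prob (E3 n) \<le> r / 4" .
      moreover have "prob (E4 n) = 0" unfolding E4_def by (rule prob_funpow_induced_map_leaves)
      ultimately show ?thesis using elim(1,2) r by linarith
    qed
    finally show ?case by simp
  qed
qed (auto intro!: always_eventually intro: less_le_trans)

text \<open>The two normalizations have ratio tending to 1 and the normalized sums are tight: where
  a sum is at most \<open>C\<close> times its normalization, a relative error below
  \<open>e / C\<close> changes the quotient by at most \<open>e\<close>.\<close>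

lemma induced_sum_rescale_tendsto_0:
  assumes e: "0 < e"
  shows "(\<lambda>n. prob {y\<in>Y. e < \<bar>S\<^sub>Y (mean_returns n) y / B (real n)
      - S\<^sub>Y (mean_returns n) y / B (real (mean_returns n) / prob Y)\<bar>}) \<longlonglongrightarrow> 0"
proof (rule order_tendstoI)
  fix r :: real assume r: "0 < r"
  obtain C where C: "0 < C" "\<And>m. 1 \<le> m \<Longrightarrow>
      prob {y\<in>Y. \<exists>k\<in>{1..m}. C * B (real m / prob Y) < \<bar>S\<^sub>Y k y\<bar>} \<le> r / 2"
    using tight_maxima[of "r / 2"] r by auto
  let ?b = "\<lambda>n. B (real (mean_returns n) / prob Y)"
  have "(\<lambda>n. \<bar>?b n / B (real n) - 1\<bar>) \<longlonglongrightarrow> \<bar>1 - 1\<bar>"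
    unfolding mean_returns_def by (intro tendsto_intros B_floor_ratio Y_pos)
  then have "\<forall>\<^sub>F n in sequentially. \<bar>?b n / B (real n) - 1\<bar> < e / C"
    by (rule order_tendstoD) (use e C in auto)
  moreover have "\<forall>\<^sub>F n in sequentially. 1 \<le> mean_returns n"
    using mean_returns_at_top by (auto simp: filterlim_at_top)
  ultimately show "\<forall>\<^sub>F n in sequentially. prob {y\<in>Y. e < \<bar>S\<^sub>Y (mean_returns n) y / B (real n)
      - S\<^sub>Y (mean_returns n) y / ?b n\<bar>} < r"
  proof eventually_elim
    case (elim n)
    have b: "0 < ?b n" using elim(2) Y_pos by (intro B_pos divide_pos_pos) auto
    have "prob {y\<in>Y. e < \<bar>S\<^sub>Y (mean_returns n) y / B (real n) - S\<^sub>Y (mean_returns n) y / ?b n\<bar>}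
      \<le> prob {y\<in>Y. \<exists>k\<in>{1..mean_returns n}. C * ?b n < \<bar>S\<^sub>Y k y\<bar>}"
    proof (intro finite_measure_mono subsetI)
      fix y assume y: "y \<in> {y\<in>Y. e < \<bar>S\<^sub>Y (mean_returns n) y / B (real n) - S\<^sub>Y (mean_returns n) y / ?b n\<bar>}"
      let ?s = "S\<^sub>Y (mean_returns n) y"
      have "C * ?b n < \<bar>?s\<bar>"
      proof (rule ccontr)
        assume "\<not> C * ?b n < \<bar>?s\<bar>"
        then have "\<bar>?s\<bar> / ?b n \<le> C" using b by (simp add: pos_divide_le_eq)
        have "?s / B (real n) - ?s / ?b n = ?s / ?b n * (?b n / B (real n) - 1)"
          using b by (simp add: right_diff_distrib)
        then have "\<bar>?s / B (real n) - ?s / ?b n\<bar> = \<bar>?s\<bar> / ?b n * \<bar>?b n / B (real n) - 1\<bar>"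
          using b by (simp add: abs_mult)
        also have "\<dots> \<le> C * (e / C)"
          using \<open>\<bar>?s\<bar> / ?b n \<le> C\<close> elim(1) C b by (intro mult_mono) auto
        finally show False using y C by simp
      qed
      then show "y \<in> {y\<in>Y. \<exists>k\<in>{1..mean_returns n}. C * ?b n < \<bar>S\<^sub>Y k y\<bar>}"
        using y elim(2) by auto
    qed measurable
    also have "\<dots> \<le> r / 2" using C(2)[OF elim(2)] .
    finally show ?case using r by simp
  qed
qed (auto intro!: always_eventually intro: less_le_trans)

text \<open>Four replacements: the index by \<open>mean_returns n\<close>, then the normalization by
  \<open>B n\<close>, then the induced sum by the original one, and finally the integral over
  \<open>Y\<close> by \<open>prob Y\<close> times the integral over the whole space.\<close>

lemma iexp_birkhoff_sum_tendsto:
  assumes lim: "(\<lambda>k. \<integral>x. indicator Y x *\<^sub>R iexp (t * (S\<^sub>Y k x / B (real k / prob Y))) \<partial>M) \<longlonglongrightarrow> prob Y *\<^sub>R c"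
  shows "(\<lambda>n. \<integral>x. iexp (t * (birkhoff_sum T n f x / B (real n))) \<partial>M) \<longlonglongrightarrow> c"
proof -
  let ?I = "\<lambda>X. \<integral>x. indicator Y x *\<^sub>R iexp (t * X x) \<partial>M"
  have 1: "(\<lambda>n. ?I (\<lambda>x. S\<^sub>Y (mean_returns n) x / B (real (mean_returns n) / prob Y))) \<longlonglongrightarrow> prob Y *\<^sub>R c"
    by (rule filterlim_compose[OF lim mean_returns_at_top])
  have 2: "(\<lambda>n. ?I (\<lambda>x. S\<^sub>Y (mean_returns n) x / B (real n))
      - ?I (\<lambda>x. S\<^sub>Y (mean_returns n) x / B (real (mean_returns n) / prob Y))) \<longlonglongrightarrow> 0"
    by (rule iexp_integral_diff_tendsto_0[OF _ _ _ induced_sum_rescale_tendsto_0]) measurable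
  have 3: "(\<lambda>n. ?I (\<lambda>x. birkhoff_sum T n f x / B (real n)) - ?I (\<lambda>x. S\<^sub>Y (mean_returns n) x / B (real n))) \<longlonglongrightarrow> 0"
    by (rule iexp_integral_diff_tendsto_0[OF _ _ _ birkhoff_sum_induced_diff_tendsto_0]) measurable
  have 4: "(\<lambda>n. ?I (\<lambda>x. birkhoff_sum T n f x / B (real n))
      - prob Y *\<^sub>R (\<integral>x. iexp (t * (birkhoff_sum T n f x / B (real n))) \<partial>M)) \<longlonglongrightarrow> 0"
    by (rule iexp_integral_asymp_indep[OF _ _ birkhoff_sum_asymp_invariant[OF _ B_seq_at_top]]) measurable
  have "(\<lambda>n. prob Y *\<^sub>R (\<integral>x. iexp (t * (birkhoff_sum T n f x / B (real n))) \<partial>M)) \<longlonglongrightarrow> prob Y *\<^sub>R c"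
    using tendsto_diff[OF tendsto_add[OF tendsto_add[OF 1 2] 3] 4] by simp
  then have "(\<lambda>n. inverse (prob Y) *\<^sub>R prob Y *\<^sub>R (\<integral>x. iexp (t * (birkhoff_sum T n f x / B (real n))) \<partial>M))
      \<longlonglongrightarrow> inverse (prob Y) *\<^sub>R prob Y *\<^sub>R c"
    by (rule tendsto_scaleR[OF tendsto_const])
  then show ?thesis using Y_pos by simp
qed

end

section \<open>Conditional measures and the conclusion by Levy's continuity theorem\<close>

lemma integral_uniform_measure:
  fixes g :: "'a \<Rightarrow> 'b :: {banach, second_countable_topology}"
  assumes "finite_measure M" and [measurable]: "A \<in> sets M" "g \<in> borel_measurable M"
    and pos: "0 < measure M A"
  shows "measure M A *\<^sub>R (\<integral>x. g x \<partial>uniform_measure M A) = (\<integral>x. indicator A x *\<^sub>R g x \<partial>M)"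
proof -
  interpret finite_measure M by fact
  have "uniform_measure M A = density M (\<lambda>x. ennreal (indicator A x / measure M A))"
    unfolding uniform_measure_def using pos
    by (intro density_cong) (auto simp: emeasure_eq_measure divide_ennreal[symmetric] indicator_def)
  then have "(\<integral>x. g x \<partial>uniform_measure M A) = (\<integral>x. (indicator A x / measure M A) *\<^sub>R g x \<partial>M)"
    by (simp add: integral_density)
  also have "\<dots> = (\<integral>x. inverse (measure M A) *\<^sub>R (indicator A x *\<^sub>R g x) \<partial>M)"
    by (simp add: divide_inverse mult.commute)
  also have "\<dots> = inverse (measure M A) *\<^sub>R (\<integral>x. indicator A x *\<^sub>R g x \<partial>M)"
    by (rule integral_scaleR_right)
  finally show ?thesis using pos by simp
qed

theorem theorem2p12:
  fixes M :: "'a measure" and T :: "'a \<Rightarrow> 'a" and Y :: "'a set" and f :: "'a \<Rightarrow> real"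
    and B :: "real \<Rightarrow> real" and P :: "'b measure" and W :: "'b \<Rightarrow> real"
  assumes "prob_space M"
    and "ergodic_endomorphism M T"
    and "Y \<in> sets M" and "0 < measure M Y"
    and "integrable M f"
    and "renormalization_function B"
    and "prob_space P" and "W \<in> borel_measurable P"
    and "converges_with_tight_maxima (uniform_measure M Y)
           (\<lambda>n. birkhoff_sum (induced_map T Y) n (induced_fun T Y f))
           (\<lambda>n. B (real n / measure M Y)) P W"
  shows "converges_in_law M (\<lambda>n x. birkhoff_sum T n f x / B (real n)) P W"
proof -
  obtain d L where "0 < d" "normalized_slowly_varying L" "\<And>x. 0 < x \<Longrightarrow> B x = x powr d * L x"
    using assms(6) by (auto simp: renormalization_function_def)
  then interpret renormalization B L d by unfold_locales
  interpret prob_space M by fact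
  interpret induced_system M T Y
    by unfold_locales (use assms(2-4) in \<open>auto simp: ergodic_endomorphism_def\<close>)
  have f [measurable]: "f \<in> borel_measurable M" using assms(5) by auto
  let ?S = "\<lambda>k. birkhoff_sum T\<^sub>Y k (induced_fun T Y f)" and ?p = "prob Y" and ?\<mu> = "uniform_measure M Y"
  have p: "emeasure M Y \<noteq> 0" "emeasure M Y \<noteq> \<infinity>"
    using Y_pos by (auto simp: emeasure_eq_measure)
  interpret \<mu>: prob_space ?\<mu> by (rule prob_space_uniform_measure[OF p])
  have conv: "weak_conv_m (\<lambda>n. distr ?\<mu> borel (\<lambda>x. ?S n x / B (real n / ?p))) (distr P borel W)"
    and tight: "tight (\<lambda>n. distr ?\<mu> borel (\<lambda>x. (MAX k\<in>{1..Suc n}. \<bar>?S k x\<bar>) / B (real (Suc n) / ?p)))"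
    using assms(9) by (simp_all add: converges_with_tight_maxima_def converges_in_law_def)
  interpret induced_renormalization M T Y B L d f
  proof unfold_locales
    fix \<eta> :: real assume \<eta>: "0 < \<eta>"
    obtain a b where ab: "a < b" "\<And>n. 1 - \<eta> <
        measure (distr ?\<mu> borel (\<lambda>x. (MAX k\<in>{1..Suc n}. \<bar>?S k x\<bar>) / B (real (Suc n) / ?p))) {a<..b}"
      using tight \<eta> unfolding tight_def by meson
    \<comment> \<open>The upper end \<open>b\<close> of the interval from tightness serves as the
      bound; the maximum with 1 makes it positive.\<close>
    define C where "C = max 1 b"
    show "\<exists>C>0. \<forall>m\<ge>1. prob {y\<in>Y. \<exists>k\<in>{1..m}. C * B (real m / ?p) < \<bar>?S k y\<bar>} \<le> \<eta>"
    proof (intro exI[of _ C] conjI allI impI)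
      fix m :: nat assume m: "1 \<le> m"
      \<comment> \<open>Undoes the shift of index in the tightness assumption.\<close>
      then obtain n where n: "m = Suc n" by (cases m) auto
      define V where "V x = (MAX k\<in>{1..m}. \<bar>?S k x\<bar>) / B (real m / ?p)" for x
      have [measurable]: "V \<in> borel_measurable M"
        unfolding V_def[abs_def] by measurable
      let ?D = "{y\<in>Y. \<exists>k\<in>{1..m}. C * B (real m / ?p) < \<bar>?S k y\<bar>}"
      have Bm: "0 < B (real m / ?p)" using m Y_pos by (intro B_pos divide_pos_pos) auto
      have "V y \<notin> {a<..b}" if y: "y \<in> ?D" for y
      proof -
        obtain k where k: "k \<in> {1..m}" "C * B (real m / ?p) < \<bar>?S k y\<bar>" using y by auto
        have "\<bar>?S k y\<bar> \<le> (MAX k\<in>{1..m}. \<bar>?S k y\<bar>)" using k(1) by (intro Max_ge) auto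
        with k(2) have "C < V y" using Bm by (simp add: V_def pos_less_divide_eq)
        then show ?thesis by (simp add: C_def)
      qed
      then have "?D \<subseteq> space M - (V -` {a<..b} \<inter> space M)"
        using sets.sets_into_space[OF Y] by blast
      then have "\<mu>.prob ?D \<le> \<mu>.prob (space M - (V -` {a<..b} \<inter> space M))"
        by (rule \<mu>.finite_measure_mono) measurable
      also have "\<dots> = 1 - \<mu>.prob (V -` {a<..b} \<inter> space M)"
        using \<mu>.prob_compl[of "V -` {a<..b} \<inter> space M"] by simp
      also have "\<dots> \<le> \<eta>"
        using ab(2)[of n] by (simp add: measure_distr V_def[abs_def] n)
      finally have "\<mu>.prob ?D \<le> \<eta>" .
      moreover have "Y \<inter> ?D = ?D" by auto
      then have "\<mu>.prob ?D = prob ?D / ?p" using p by (subst measure_uniform_measure) auto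
      ultimately have "prob ?D \<le> \<eta> * ?p" using Y_pos by (simp add: pos_divide_le_eq)
      also have "\<dots> \<le> \<eta> * 1" using \<eta> by (intro mult_left_mono) auto
      finally show "prob ?D \<le> \<eta>" by simp
    qed (simp add: C_def)
  qed (rule f)
  have W: "real_distribution (distr P borel W)"
    using assms(7,8) by (intro prob_space.real_distribution_distr) auto
  have "(\<lambda>n. char (distr M borel (\<lambda>x. birkhoff_sum T n f x / B (real n))) t) \<longlonglongrightarrow> char (distr P borel W) t" for t
  proof -
    \<comment> \<open>Weak convergence is turned into convergence of characteristic functions, where
      the change of measure takes place, and turned back at the end.\<close>
    have "(\<lambda>n. char (distr ?\<mu> borel (\<lambda>x. ?S n x / B (real n / ?p))) t) \<longlonglongrightarrow> char (distr P borel W) t"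
      by (rule levy_continuity1[OF _ W conv]) (intro \<mu>.real_distribution_distr; measurable)
    then have "(\<lambda>n. ?p *\<^sub>R (\<integral>x. iexp (t * (?S n x / B (real n / ?p))) \<partial>?\<mu>)) \<longlonglongrightarrow> ?p *\<^sub>R char (distr P borel W) t"
      by (intro tendsto_scaleR tendsto_const) (simp add: char_def integral_distr)
    moreover have "?p *\<^sub>R (\<integral>x. iexp (t * (?S n x / B (real n / ?p))) \<partial>?\<mu>)
      = (\<integral>x. indicator Y x *\<^sub>R iexp (t * (?S n x / B (real n / ?p))) \<partial>M)" for n
      by (rule integral_uniform_measure) (auto intro: finite_measure_axioms Y_pos)
    ultimately have "(\<lambda>n. \<integral>x. iexp (t * (birkhoff_sum T n f x / B (real n))) \<partial>M) \<longlonglongrightarrow> char (distr P borel W) t"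
      by (intro iexp_birkhoff_sum_tendsto) simp
    then show ?thesis by (simp add: char_def integral_distr)
  qed
  then show ?thesis
    unfolding converges_in_law_def
    by (intro levy_continuity W real_distribution_distr) measurable
qed

end
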